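(* Let $Q$ be an acyclic quiver, $K$ a field and $M\in \mathrm{rep}_K(Q)$ a thin representation such that the underlying graph of $\mathrm{supp}(M)$ is either a tree or a cycle. Let $l$ be a length function on $\mathrm{mod}\text{-}KQ$ and $w$ its induced weight function, given by $w(i)=l(S(i))$ for $i\in Q_0$, with the induced length function $w$ on $\mathcal{L}(Q)$. Then $\mu_l(M)=w^*(\mathrm{supp}(M))$, and if $\mathcal{Q}$ is a $w^*$-filtration of $\mathrm{supp}(M)$, then the canonical representations of the quivers from $\mathcal{Q}$ form a GR filtration of $M$ (with respect to $l$).
   Context: Quivers and representations. A quiver $Q=(Q_0,Q_1,s,t)$ has a finite nonempty set $Q_0$ of vertices, a finite set $Q_1$ of arrows, and source and target maps $s,t:Q_1\to Q_0$. It is acyclic if it contains no oriented cycles. A subquiver of $Q$ is a quiver whose vertex and arrow sets are subsets of $Q_0$ and $Q_1$ and whose source and target maps are restrictions of $s$ and $t$. The underlying graph is the multigraph obtained by forgetting the orientation of the arrows; a cycle here has $n+1$ vertices with $n>0$. For a field $K$, $\mathrm{rep}_K(Q)$ is the category of $K$-linear representations $M$ of $Q$: finite-dimensional $K$-vector spaces $M_a$ ($a\in Q_0$) and $K$-linear structural maps $M_\alpha:M_{s(\alpha)}\to M_{t(\alpha)}$ ($\alpha\in Q_1$). It is equivalent to the category $\mathrm{mod}\text{-}KQ$ of finitely generated right modules over the path algebra $KQ$, and the two are identified. $S(i)$ is the simple representation whose support is the single vertex $i$. $M$ is thin if $\dim_K(M_a)\le 1$ for all $a\in Q_0$. The support $\mathrm{supp}(M)$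 is the subquiver of $Q$ given by the vertices and arrows whose vector spaces and structural maps are nonzero. A thin representation is canonical if all its structural maps along arrows of its support are identity maps; the canonical representation of a subquiver is the canonical one with that subquiver as its support. The poset $\mathcal{L}(Q)$. $\mathcal{L}(Q)$ is the set of connected subquivers of $Q$, partially ordered by $\le_C$, where $Q'\le_C Q''$ if $Q'$ is a subquiver of $Q''$ and, whenever an arrow $\alpha\in Q''_1$ has its source in $Q'_0$, its target is also in $Q'_0$. A weight function on $Q$ is a map $w:Q_0\to\mathbb{R}^+$; it induces a length function on $\mathcal{L}(Q)$, also denoted $w$, mapping each connected subquiver to the sum of the weights of its vertices. Length functions on module categories. A length function on an abelian length category (here $\mathrm{mod}\text{-}KQ$) is a map $l$ from isomorphism classes of objects to the nonnegative reals such that $l(X)=0$ if and only if $X=0$, and $l(Y)=l(X)+l(Z)$ for every short exact sequence $0\to X\to Y\to Z\to 0$. Induced chain length functions. A real-valued length function on a poset $S$ is a map $f:S\to\mathbb{R}$ such that $x<y$ implies $f(x)<f(y)$ and such that $\{f(x')\mid x'\le y\}$ is finite for each $y$. Finite subsets of $\mathbb{R}$ are ordered lexicographically: $A\le_L B$ iff $\min(B\setminus A)\le\min(A\setminus B)$, with the convention that $\min(\emptyset)$ is larger than every element. For a finite chain $X$ in $S$ put $f(X)=\{f(x)\mid x\in X\}$, and let $f^*(x)$ be the $\le_L$-maximum of the sets $f(X)$ over all finite chains $X$ in $S$ with maximum $x$. A filtration of $x$ is a finite chain $(x_1<\dots<x_n=x)$ with $x_1$ minimal in $S$ and each $x_i$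 ($i<n$) a direct predecessor of $x_{i+1}$ (no element lies strictly between them). It is an $f^*$-filtration of $x$ if $f(X)=f^*(x)$ for this chain $X$. GR measure. For an indecomposable object $X$, let $\mathcal{L}(X)$ be the set of its indecomposable subobjects ordered by inclusion, with the length function obtained by restricting $l$. The Gabriel-Roiter (GR) measure of $X$ with respect to $l$ is $\mu_l(X)=l^*(X)$, and a GR filtration of $X$ with respect to $l$ is an $l^*$-filtration of $X$.
   Formalization: If supp(M) is a cycle, the GR filtration consists of the restrictions of M to the vertices of the quivers in the w*-filtration; these are shown isomorphic to canonical representations only for quivers missing a vertex of the cycle, as the claim fails for the cycle itself or minus an arrow. *)

theory Defs
  imports
    "HOL-Library.Extended_Real"
    "HOL-Library.Function_Algebras"
    "Graph_Theory.Digraph_Component"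
begin

section \<open>Quivers\<close>

definition quiver :: "('a, 'b) pre_digraph \<Rightarrow> bool" where
  "quiver Q \<longleftrightarrow> fin_digraph Q \<and> verts Q \<noteq> {}"

definition acyclic_quiver :: "('a, 'b) pre_digraph \<Rightarrow> bool" where
  "acyclic_quiver Q \<longleftrightarrow> quiver Q \<and> (\<nexists>p. pre_digraph.cycle Q p)"

text \<open>
  Subquivers are rendered by \<^const>\<open>subgraph\<close> and connectedness of the underlying graph
  by \<^const>\<open>Digraph_Component.connected\<close>, which includes nonemptiness. The constants
  \<^const>\<open>Digraph_Component.forest\<close> and \<^const>\<open>Digraph_Component.tree\<close> only exclude oriented
  cycles; cycles and trees of the underlying multigraph are therefore defined here.
  Two parallel or antiparallel arrows form a cycle with two vertices.
\<close>

definition underlying_cycle :: "('a, 'b) pre_digraph \<Rightarrow> bool" where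
  "underlying_cycle R \<longleftrightarrow>
     (\<exists>n>0. \<exists>v e. bij_betw v {..n} (verts R) \<and> bij_betw e {..n} (arcs R) \<and>
        (\<forall>i\<le>n. {tail R (e i), head R (e i)} = {v i, v (Suc i mod Suc n)}))"

definition underlying_tree :: "('a, 'b) pre_digraph \<Rightarrow> bool" where
  "underlying_tree R \<longleftrightarrow> Digraph_Component.connected R \<and>
     (\<forall>\<alpha>\<in>arcs R. tail R \<alpha> \<noteq> head R \<alpha>) \<and>
     (\<nexists>C. subgraph C R \<and> underlying_cycle C)"

definition connected_subquivers :: "('a, 'b) pre_digraph \<Rightarrow> ('a, 'b) pre_digraph set" where
  "connected_subquivers Q = {R. subgraph R Q \<and> Digraph_Component.connected R}"

text \<open>
  This relation requires the target, but not the arrow itself, to lie in \<open>R\<close>. Hence a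
  cycle with one arrow removed lies strictly below the cycle although both have the same
  vertices. Below a tree the relation is a partial order and the arrow is automatically
  contained in \<open>R\<close>.
\<close>

definition le_C :: "('a, 'b) pre_digraph \<Rightarrow> ('a, 'b) pre_digraph \<Rightarrow> bool" where
  "le_C R T \<longleftrightarrow> subgraph R T \<and>
     (\<forall>\<alpha>\<in>arcs T. tail T \<alpha> \<in> verts R \<longrightarrow> head T \<alpha> \<in> verts R)"

definition weight_length :: "('a \<Rightarrow> real) \<Rightarrow> ('a, 'b) pre_digraph \<Rightarrow> real" where
  "weight_length w R = (\<Sum>i\<in>verts R. w i)"

section \<open>Induced chain length functions\<close>

definition min_or_infinity :: "real set \<Rightarrow> ereal" where
  "min_or_infinity A = (if A = {} then \<infinity> else ereal (Min A))"

definition le_L :: "real set \<Rightarrow> real set \<Rightarrow> bool" where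
  "le_L A B \<longleftrightarrow> min_or_infinity (B - A) \<le> min_or_infinity (A - B)"

text \<open>A set \<open>S\<close> is ordered by \<open>le\<close>; the strict order is \<open>le x y \<and> x \<noteq> y\<close>.\<close>

definition finite_chain_to :: "'p set \<Rightarrow> ('p \<Rightarrow> 'p \<Rightarrow> bool) \<Rightarrow> 'p \<Rightarrow> 'p set \<Rightarrow> bool" where
  "finite_chain_to S le x X \<longleftrightarrow> X \<subseteq> S \<and> finite X \<and>
     (\<forall>y\<in>X. \<forall>z\<in>X. le y z \<or> le z y) \<and> x \<in> X \<and> (\<forall>y\<in>X. le y x)"

definition chain_length :: "'p set \<Rightarrow> ('p \<Rightarrow> 'p \<Rightarrow> bool) \<Rightarrow> ('p \<Rightarrow> real) \<Rightarrow> 'p \<Rightarrow> real set" where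
  "chain_length S le f x =
     (THE A. (\<exists>X. finite_chain_to S le x X \<and> A = f ` X) \<and>
             (\<forall>X. finite_chain_to S le x X \<longrightarrow> le_L (f ` X) A))"

definition minimal_in :: "'p set \<Rightarrow> ('p \<Rightarrow> 'p \<Rightarrow> bool) \<Rightarrow> 'p \<Rightarrow> bool" where
  "minimal_in S le x \<longleftrightarrow> x \<in> S \<and> (\<forall>y\<in>S. le y x \<longrightarrow> y = x)"

definition direct_predecessor :: "'p set \<Rightarrow> ('p \<Rightarrow> 'p \<Rightarrow> bool) \<Rightarrow> 'p \<Rightarrow> 'p \<Rightarrow> bool" where
  "direct_predecessor S le x y \<longleftrightarrow> x \<in> S \<and> y \<in> S \<and> le x y \<and> x \<noteq> y \<and>
     \<not> (\<exists>z\<in>S. le x z \<and> x \<noteq> z \<and> le z y \<and> z \<noteq> y)"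

definition filtration :: "'p set \<Rightarrow> ('p \<Rightarrow> 'p \<Rightarrow> bool) \<Rightarrow> 'p \<Rightarrow> 'p set \<Rightarrow> bool" where
  "filtration S le x X \<longleftrightarrow>
     (\<exists>xs. xs \<noteq> [] \<and> X = set xs \<and> X \<subseteq> S \<and>
        sorted_wrt (\<lambda>y z. le y z \<and> y \<noteq> z) xs \<and> last xs = x \<and> minimal_in S le (hd xs) \<and>
        (\<forall>i. Suc i < length xs \<longrightarrow> direct_predecessor S le (xs ! i) (xs ! Suc i)))"

definition star_filtration ::
    "'p set \<Rightarrow> ('p \<Rightarrow> 'p \<Rightarrow> bool) \<Rightarrow> ('p \<Rightarrow> real) \<Rightarrow> 'p \<Rightarrow> 'p set \<Rightarrow> bool" where
  "star_filtration S le f x X \<longleftrightarrow> filtration S le x X \<and> f ` X = chain_length S le f x"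

section \<open>Representations\<close>

text \<open>
  The finite-dimensional vector spaces of a representation are taken to be subspaces of
  the infinite-dimensional space of all sequences over the field; up to isomorphism this
  yields all finite-dimensional representations.
\<close>

type_synonym 'k seq = "nat \<Rightarrow> 'k"

definition seq_scale :: "'k::field \<Rightarrow> 'k seq \<Rightarrow> 'k seq" where
  "seq_scale c v = (\<lambda>n. c * v n)"

global_interpretation seqs: vector_space "seq_scale :: 'k::field \<Rightarrow> 'k seq \<Rightarrow> 'k seq"
  by unfold_locales (auto simp: seq_scale_def fun_eq_iff algebra_simps)

definition finite_dim_subspace :: "'k::field seq set \<Rightarrow> bool" where
  "finite_dim_subspace V \<longleftrightarrow> seqs.subspace V \<and> (\<exists>B. finite B \<and> seqs.span B = V)"

definition linear_on :: "'k::field seq set \<Rightarrow> 'k seq set \<Rightarrow> ('k seq \<Rightarrow> 'k seq) \<Rightarrow> bool" where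
  "linear_on U V f \<longleftrightarrow> f ` U \<subseteq> V \<and>
     (\<forall>u\<in>U. \<forall>v\<in>U. f (u + v) = f u + f v) \<and>
     (\<forall>c. \<forall>u\<in>U. f (seq_scale c u) = seq_scale c (f u))"

record ('a, 'b, 'k) qrep =
  rspace :: "'a \<Rightarrow> 'k seq set"
  rmap :: "'b \<Rightarrow> 'k seq \<Rightarrow> 'k seq"

text \<open>
  Values outside the relevant domains are fixed to be zero, so that two representations
  with the same spaces and the same structural maps are equal as records and inclusion
  of subrepresentations is antisymmetric.
\<close>

definition representation :: "('a, 'b) pre_digraph \<Rightarrow> ('a, 'b, 'k::field) qrep \<Rightarrow> bool" where
  "representation Q M \<longleftrightarrow>
     (\<forall>a\<in>verts Q. finite_dim_subspace (rspace M a)) \<and>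
     (\<forall>\<alpha>\<in>arcs Q. linear_on (rspace M (tail Q \<alpha>)) (rspace M (head Q \<alpha>)) (rmap M \<alpha>)) \<and>
     (\<forall>a. a \<notin> verts Q \<longrightarrow> rspace M a = {0}) \<and>
     (\<forall>\<alpha> v. \<alpha> \<notin> arcs Q \<or> v \<notin> rspace M (tail Q \<alpha>) \<longrightarrow> rmap M \<alpha> v = 0)"

definition rep_hom :: "('a, 'b) pre_digraph \<Rightarrow> ('a, 'b, 'k::field) qrep \<Rightarrow> ('a, 'b, 'k) qrep \<Rightarrow>
    ('a \<Rightarrow> 'k seq \<Rightarrow> 'k seq) \<Rightarrow> bool" where
  "rep_hom Q X Y \<phi> \<longleftrightarrow>
     (\<forall>a\<in>verts Q. linear_on (rspace X a) (rspace Y a) (\<phi> a)) \<and>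
     (\<forall>\<alpha>\<in>arcs Q. \<forall>v\<in>rspace X (tail Q \<alpha>).
        \<phi> (head Q \<alpha>) (rmap X \<alpha> v) = rmap Y \<alpha> (\<phi> (tail Q \<alpha>) v))"

definition rep_iso :: "('a, 'b) pre_digraph \<Rightarrow> ('a, 'b, 'k::field) qrep \<Rightarrow> ('a, 'b, 'k) qrep \<Rightarrow> bool" where
  "rep_iso Q X Y \<longleftrightarrow>
     (\<exists>\<phi>. rep_hom Q X Y \<phi> \<and> (\<forall>a\<in>verts Q. bij_betw (\<phi> a) (rspace X a) (rspace Y a)))"

definition short_exact :: "('a, 'b) pre_digraph \<Rightarrow>
    ('a, 'b, 'k::field) qrep \<Rightarrow> ('a, 'b, 'k) qrep \<Rightarrow> ('a, 'b, 'k) qrep \<Rightarrow>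
    ('a \<Rightarrow> 'k seq \<Rightarrow> 'k seq) \<Rightarrow> ('a \<Rightarrow> 'k seq \<Rightarrow> 'k seq) \<Rightarrow> bool" where
  "short_exact Q X Y Z \<phi> \<psi> \<longleftrightarrow> rep_hom Q X Y \<phi> \<and> rep_hom Q Y Z \<psi> \<and>
     (\<forall>a\<in>verts Q. inj_on (\<phi> a) (rspace X a) \<and>
        \<phi> a ` rspace X a = {v \<in> rspace Y a. \<psi> a v = 0} \<and>
        \<psi> a ` rspace Y a = rspace Z a)"

definition zero_rep :: "('a, 'b) pre_digraph \<Rightarrow> ('a, 'b, 'k::field) qrep \<Rightarrow> bool" where
  "zero_rep Q X \<longleftrightarrow> (\<forall>a\<in>verts Q. rspace X a = {0})"

definition subrep :: "('a, 'b) pre_digraph \<Rightarrow> ('a, 'b, 'k::field) qrep \<Rightarrow> ('a, 'b, 'k) qrep \<Rightarrow> bool" where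
  "subrep Q N M \<longleftrightarrow> representation Q N \<and> representation Q M \<and>
     (\<forall>a\<in>verts Q. rspace N a \<subseteq> rspace M a) \<and>
     (\<forall>\<alpha>\<in>arcs Q. \<forall>v\<in>rspace N (tail Q \<alpha>). rmap N \<alpha> v = rmap M \<alpha> v)"

definition direct_sum_of :: "('a, 'b) pre_digraph \<Rightarrow>
    ('a, 'b, 'k::field) qrep \<Rightarrow> ('a, 'b, 'k) qrep \<Rightarrow> ('a, 'b, 'k) qrep \<Rightarrow> bool" where
  "direct_sum_of Q M U V \<longleftrightarrow> subrep Q U M \<and> subrep Q V M \<and>
     (\<forall>a\<in>verts Q. rspace U a \<inter> rspace V a = {0} \<and>
        rspace M a = {u + v | u v. u \<in> rspace U a \<and> v \<in> rspace V a})"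

definition indecomposable :: "('a, 'b) pre_digraph \<Rightarrow> ('a, 'b, 'k::field) qrep \<Rightarrow> bool" where
  "indecomposable Q M \<longleftrightarrow> representation Q M \<and> \<not> zero_rep Q M \<and>
     (\<forall>U V. direct_sum_of Q M U V \<longrightarrow> zero_rep Q U \<or> zero_rep Q V)"

definition thin :: "('a, 'b) pre_digraph \<Rightarrow> ('a, 'b, 'k::field) qrep \<Rightarrow> bool" where
  "thin Q M \<longleftrightarrow> (\<forall>a\<in>verts Q. seqs.dim (rspace M a) \<le> 1)"

definition supp :: "('a, 'b) pre_digraph \<Rightarrow> ('a, 'b, 'k::field) qrep \<Rightarrow> ('a, 'b) pre_digraph" where
  "supp Q M = \<lparr>verts = {a \<in> verts Q. rspace M a \<noteq> {0}},
               arcs = {\<alpha> \<in> arcs Q. \<exists>v\<in>rspace M (tail Q \<alpha>). rmap M \<alpha> v \<noteq> 0},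
               tail = tail Q, head = head Q\<rparr>"

definition unit_line :: "'k::field seq set" where
  "unit_line = seqs.span {\<lambda>n. if n = 0 then 1 else 0}"

definition canonical_rep :: "('a, 'b) pre_digraph \<Rightarrow> ('a, 'b, 'k::field) qrep" where
  "canonical_rep R =
     \<lparr>rspace = (\<lambda>a. if a \<in> verts R then unit_line else {0}),
      rmap = (\<lambda>\<alpha> v. if \<alpha> \<in> arcs R \<and> v \<in> unit_line then v else 0)\<rparr>"

definition simple_rep :: "'a \<Rightarrow> ('a, 'b, 'k::field) qrep" where
  "simple_rep i = \<lparr>rspace = (\<lambda>a. if a = i then unit_line else {0}), rmap = (\<lambda>\<alpha> v. 0)\<rparr>"

text \<open>
  The part of \<open>M\<close> living on the vertices of \<open>R\<close>; it is a subrepresentation of \<open>M\<close>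
  whenever the vertices of \<open>R\<close> are closed under successors in the support of \<open>M\<close>.
  If \<open>M\<close> is thin with support a tree, it is isomorphic to the canonical representation of
  \<open>R\<close> for every \<open>R\<close> below the support with respect to \<^const>\<open>le_C\<close>. If the support is a
  cycle this holds except possibly for the \<open>R\<close> containing all of its vertices, i.e. the cycle
  itself, on which \<open>M\<close> may have nontrivial monodromy, and the cycle with one arrow
  removed, whose canonical representation does not embed into \<open>M\<close>; for these the
  restriction is \<open>M\<close>.
\<close>

definition restrict_rep :: "('a, 'b) pre_digraph \<Rightarrow> ('a, 'b, 'k::field) qrep \<Rightarrow>
    ('a, 'b) pre_digraph \<Rightarrow> ('a, 'b, 'k) qrep" where
  "restrict_rep Q M R =
     \<lparr>rspace = (\<lambda>a. if a \<in> verts R then rspace M a else {0}),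
      rmap = (\<lambda>\<alpha> v. if tail Q \<alpha> \<in> verts R then rmap M \<alpha> v else 0)\<rparr>"

section \<open>Length functions and the Gabriel-Roiter measure\<close>

definition length_function :: "('a, 'b) pre_digraph \<Rightarrow> (('a, 'b, 'k::field) qrep \<Rightarrow> real) \<Rightarrow> bool" where
  "length_function Q l \<longleftrightarrow>
     (\<forall>X. representation Q X \<longrightarrow> l X \<ge> 0 \<and> (l X = 0 \<longleftrightarrow> zero_rep Q X)) \<and>
     (\<forall>X Y. representation Q X \<and> representation Q Y \<and> rep_iso Q X Y \<longrightarrow> l X = l Y) \<and>
     (\<forall>X Y Z \<phi> \<psi>. representation Q X \<and> representation Q Y \<and> representation Q Z \<and>
        short_exact Q X Y Z \<phi> \<psi> \<longrightarrow> l Y = l X + l Z)"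

definition indec_subobjects :: "('a, 'b) pre_digraph \<Rightarrow> ('a, 'b, 'k::field) qrep \<Rightarrow> ('a, 'b, 'k) qrep set" where
  "indec_subobjects Q M = {N. subrep Q N M \<and> indecomposable Q N}"

definition gr_measure :: "('a, 'b) pre_digraph \<Rightarrow> (('a, 'b, 'k::field) qrep \<Rightarrow> real) \<Rightarrow>
    ('a, 'b, 'k) qrep \<Rightarrow> real set" where
  "gr_measure Q l M = chain_length (indec_subobjects Q M) (subrep Q) l M"

definition gr_filtration :: "('a, 'b) pre_digraph \<Rightarrow> (('a, 'b, 'k::field) qrep \<Rightarrow> real) \<Rightarrow>
    ('a, 'b, 'k) qrep \<Rightarrow> ('a, 'b, 'k) qrep set \<Rightarrow> bool" where
  "gr_filtration Q l M = star_filtration (indec_subobjects Q M) (subrep Q) l M"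

end

theory Submission
  imports Defs
begin

text \<open>
  Subrepresentations of a thin representation \<open>M\<close> correspond to vertex sets closed under
  successors in the support, indecomposable ones to those spanning a connected subquiver. Taking
  supports, and conversely restricting \<open>M\<close> to a subquiver, turns chains below \<open>M\<close> into chains
  below the support with the same set of lengths and vice versa, so the two maxima agree.

  Restriction need not preserve direct predecessors: on a cycle it identifies the cycle with the
  cycle minus an arrow, and a closed set containing both ends of that arrow is lost in between.
  What makes the image of a \<open>w\<^sup>*\<close>-filtration a filtration is that its set of lengths is maximal,
  since a chain that can be refined does not have maximal length.

  The restriction to a subquiver without cycles is canonical because basis vectors compatible with
  the structural maps can be chosen arrow by arrow.
\<close>

section \<open>Chain length functions\<close>

lemma le_L_iff:
  assumes "finite A" "finite B"
  shows "le_L A B \<longleftrightarrow> A = B \<or> (\<exists>m\<in>B - A. \<forall>x<m. x \<in> A \<longleftrightarrow> x \<in> B)"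
proof
  assume le: "le_L A B"
  show "A = B \<or> (\<exists>m\<in>B - A. \<forall>x<m. x \<in> A \<longleftrightarrow> x \<in> B)"
  proof (cases "B - A = {}")
    case True
    then have "A - B = {}"
      using le by (auto simp: le_L_def min_or_infinity_def split: if_splits)
    then show ?thesis using True by blast
  next
    case False
    \<comment> \<open>The decisive element is the least one of \<open>B - A\<close>: a smaller
      element of \<open>A - B\<close> would contradict \<open>le_L A B\<close>, so the two sets
      agree below it. In this form the comparison no longer mentions infinity.\<close>
    have m: "Min (B - A) \<in> B - A" using False assms by (intro Min_in) auto
    have "\<forall>x<Min (B - A). x \<in> A \<longleftrightarrow> x \<in> B"
    proof (intro allI impI)
      fix x assume x: "x < Min (B - A)"
      have "x \<notin> B - A" using x assms by (meson Min_le finite_Diff leD)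
      moreover have "x \<notin> A - B"
      proof
        assume xA: "x \<in> A - B"
        then have "Min (A - B) \<le> x" using assms by (intro Min_le) auto
        moreover have "Min (B - A) \<le> Min (A - B)"
          using le False xA by (auto simp: le_L_def min_or_infinity_def split: if_splits)
        ultimately show False using x by linarith
      qed
      ultimately show "x \<in> A \<longleftrightarrow> x \<in> B" by blast
    qed
    with m show ?thesis by blast
  qed
next
  assume "A = B \<or> (\<exists>m\<in>B - A. \<forall>x<m. x \<in> A \<longleftrightarrow> x \<in> B)"
  then show "le_L A B"
  proof
    assume "\<exists>m\<in>B - A. \<forall>x<m. x \<in> A \<longleftrightarrow> x \<in> B"
    then obtain m where m: "m \<in> B - A" "\<And>x. x < m \<Longrightarrow> x \<in> A \<longleftrightarrow> x \<in> B" by blast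
    have "Min (B - A) \<le> Min (A - B)" if "A - B \<noteq> {}"
    proof -
      have "Min (B - A) \<le> m" using m assms by (intro Min_le) auto
      also have "Min (A - B) \<in> A - B" using that assms by (intro Min_in) auto
      then have "m \<le> Min (A - B)" using m(2) by (meson Diff_iff not_less)
      finally show ?thesis .
    qed
    then show ?thesis using m by (auto simp: le_L_def min_or_infinity_def)
  qed (simp add: le_L_def)
qed

lemma le_L_total: "le_L A B \<or> le_L B A"
  unfolding le_L_def by (rule linear)

lemma le_L_antisym:
  assumes "finite A" "finite B" "le_L A B" "le_L B A"
  shows "A = B"
proof (rule ccontr)
  assume "A \<noteq> B"
  then obtain m n where "m \<in> B - A" "\<And>x. x < m \<Longrightarrow> x \<in> A \<longleftrightarrow> x \<in> B"
      "n \<in> A - B" "\<And>x. x < n \<Longrightarrow> x \<in> B \<longleftrightarrow> x \<in> A"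
    using assms by (metis le_L_iff)
  then show False by (metis Diff_iff linorder_neqE_linordered_idom)
qed

lemma le_L_trans:
  assumes "finite A" "finite B" "finite C" "le_L A B" "le_L B C"
  shows "le_L A C"
proof (cases "A = B \<or> B = C")
  case False
  then obtain m n where m: "m \<in> B - A" "\<And>x. x < m \<Longrightarrow> x \<in> A \<longleftrightarrow> x \<in> B"
      and n: "n \<in> C - B" "\<And>x. x < n \<Longrightarrow> x \<in> B \<longleftrightarrow> x \<in> C"
    using assms by (metis le_L_iff)
  have "min m n \<in> C - A"
    using m n by (metis Diff_iff linorder_neqE_linordered_idom min.absorb3 min.absorb4)
  moreover have "\<forall>x<min m n. x \<in> A \<longleftrightarrow> x \<in> C" using m n by simp
  ultimately show ?thesis using assms le_L_iff by blast
qed (use assms in auto)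

lemma finite_le_L_maximum:
  assumes "finite F" "F \<noteq> {}" "\<And>A. A \<in> F \<Longrightarrow> finite A"
  shows "\<exists>A\<in>F. \<forall>B\<in>F. le_L B A"
  using assms
proof (induction F rule: finite_ne_induct)
  case (singleton A)
  then show ?case by (simp add: le_L_def)
next
  case (insert C F)
  then obtain A where A: "A \<in> F" "\<forall>B\<in>F. le_L B A" by auto
  show ?case
  proof (cases "le_L C A")
    case True
    then show ?thesis using A by blast
  next
    case False
    then have "le_L A C" using le_L_total insert.prems A by blast
    then have "\<forall>B\<in>insert C F. le_L B C"
      using A insert.prems by (metis insertE insertCI le_L_trans le_L_def order_refl)
    then show ?thesis by blast
  qed
qed

text \<open>The defining predicate of \<open>chain_length\<close> sees chains only through their
  sets of lengths. If both posets realise the same sets, the two predicates coincide, before any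
  maximum is known to exist.\<close>

lemma chain_length_eqI:
  assumes "\<And>X. finite_chain_to S le x X \<Longrightarrow>
      \<exists>Y. finite_chain_to S' le' x' Y \<and> f' ` Y = f ` X"
    and "\<And>Y. finite_chain_to S' le' x' Y \<Longrightarrow>
      \<exists>X. finite_chain_to S le x X \<and> f ` X = f' ` Y"
  shows "chain_length S le f x = chain_length S' le' f' x'"
proof -
  have "(\<exists>X. finite_chain_to S le x X \<and> A = f ` X) \<and>
        (\<forall>X. finite_chain_to S le x X \<longrightarrow> le_L (f ` X) A) \<longleftrightarrow>
      (\<exists>X. finite_chain_to S' le' x' X \<and> A = f' ` X) \<and>
        (\<forall>X. finite_chain_to S' le' x' X \<longrightarrow> le_L (f' ` X) A)" for A
    using assms by metis
  then show ?thesis unfolding chain_length_def by simp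
qed

text \<open>Finiteness of \<open>S\<close> leaves finitely many sets of lengths, so a greatest one
  exists, and antisymmetry makes it unique: the definite description denotes a genuine
  maximum.\<close>

lemma le_L_chain_length:
  assumes "finite S" "finite_chain_to S le x X"
  shows "le_L (f ` X) (chain_length S le f x)"
proof -
  define F where "F = (`) f ` {X. finite_chain_to S le x X}"
  have fin: "finite A" if "A \<in> F" for A
    using that by (auto simp: F_def finite_chain_to_def)
  have "{X. finite_chain_to S le x X} \<subseteq> Pow S" by (auto simp: finite_chain_to_def)
  then have "finite F" unfolding F_def using assms(1) finite_subset by blast
  moreover have "F \<noteq> {}" using assms(2) by (auto simp: F_def)
  ultimately obtain A where A: "A \<in> F" "\<forall>B\<in>F. le_L B A"
    using finite_le_L_maximum fin by meson
  let ?P = "\<lambda>A. (\<exists>X. finite_chain_to S le x X \<and> A = f ` X) \<and>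
    (\<forall>X. finite_chain_to S le x X \<longrightarrow> le_L (f ` X) A)"
  have P: "?P B \<longleftrightarrow> B \<in> F \<and> (\<forall>C\<in>F. le_L C B)" for B by (auto simp: F_def)
  have "?P (chain_length S le f x)"
    unfolding chain_length_def
  proof (rule theI)
    show "?P A" using A P by blast
    show "B = A" if "?P B" for B
      using that A fin unfolding P by (meson le_L_antisym)
  qed
  then show ?thesis using assms(2) by blast
qed

section \<open>Chains of maximal length in a finite poset with a length function\<close>

locale finite_length_poset =
  fixes S :: "'p set" and le :: "'p \<Rightarrow> 'p \<Rightarrow> bool" and f :: "'p \<Rightarrow> real"
  assumes finite: "finite S"
    and refl: "x \<in> S \<Longrightarrow> le x x"
    and antisym: "\<lbrakk>x \<in> S; y \<in> S; le x y; le y x\<rbrakk> \<Longrightarrow> x = y"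
    and trans: "\<lbrakk>x \<in> S; y \<in> S; z \<in> S; le x y; le y z\<rbrakk> \<Longrightarrow> le x z"
    and strict_mono: "\<lbrakk>x \<in> S; y \<in> S; le x y; x \<noteq> y\<rbrakk> \<Longrightarrow> f x < f y"
begin

text \<open>Comparability and strict monotonicity let the lengths decide the order within a chain,
  so chains can be sorted by sorting real numbers.\<close>

lemma chain_le_iff:
  assumes "finite_chain_to S le x X" "y \<in> X" "z \<in> X"
  shows "le y z \<longleftrightarrow> f y \<le> f z"
  using assms refl strict_mono unfolding finite_chain_to_def
  by (metis in_mono less_eq_real_def not_less)

lemma maximal_chain_no_insert:
  assumes X: "finite_chain_to S le x X" "f ` X = chain_length S le f x"
    and z: "z \<in> S" "\<And>y. y \<in> X \<Longrightarrow> le y z \<or> le z y" "le z x"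
  shows "z \<in> X"
proof (rule ccontr)
  assume "z \<notin> X"
  have "finite_chain_to S le x (insert z X)"
    using X(1) z refl[OF z(1)] unfolding finite_chain_to_def by blast
  then have "le_L (f ` insert z X) (f ` X)"
    using le_L_chain_length[OF finite] X(2) by metis
  moreover have "finite X" "X \<subseteq> S" using X(1) by (auto simp: finite_chain_to_def)
  \<comment> \<open>\<open>z\<close> is comparable with every element of \<open>X\<close> and
    different from it, so its length is new. A finite proper superset is strictly larger in
    \<open>le_L\<close>, as the first difference lies in it.\<close>
  moreover have "f z \<notin> f ` X"
    using strict_mono z \<open>z \<notin> X\<close> \<open>X \<subseteq> S\<close> by (metis imageE less_irrefl subsetD)
  ultimately show False
    by (subst (asm) le_L_iff) auto
qed

text \<open>Inserting a further element would enlarge the set of lengths, hence its position in \<open>\<le>\<^sub>L\<close>.\<close>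

lemma star_filtration_if_maximal:
  assumes X: "finite_chain_to S le x X" "f ` X = chain_length S le f x"
  shows "star_filtration S le f x X"
proof -
  have fin: "finite X" and sub: "X \<subseteq> S" and top: "x \<in> X" "\<And>y. y \<in> X \<Longrightarrow> le y x"
    using X(1) by (auto simp: finite_chain_to_def)
  have inj: "inj_on f X"
    using chain_le_iff[OF X(1)] antisym sub by (intro inj_onI) (metis order_refl subsetD)
  \<comment> \<open>\<open>f\<close> is injective on the chain, so listing its lengths in increasing
    order and inverting \<open>f\<close> enumerates the chain from bottom to top.\<close>
  define xs where "xs = map (inv_into X f) (sorted_list_of_set (f ` X))"
  have set_xs: "set xs = X" unfolding xs_def using fin inj by simp
  have sorted_f: "sorted_wrt (\<lambda>y z. f y < f z) xs"
    unfolding xs_def sorted_wrt_map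
    by (rule sorted_wrt_mono_rel[OF _ strict_sorted_list_of_set])
      (use fin in \<open>auto simp: f_inv_into_f\<close>)
  have sorted: "sorted_wrt (\<lambda>y z. le y z \<and> y \<noteq> z) xs"
    by (rule sorted_wrt_mono_rel[OF _ sorted_f])
      (auto simp: chain_le_iff[OF X(1)] set_xs)
  have ne: "xs \<noteq> []" using set_xs top by auto
  have nth_less: "f (xs ! i) < f (xs ! j)" if "i < j" "j < length xs" for i j
    using sorted_f that by (simp add: sorted_wrt_iff_nth_less)
  have nth_in: "xs ! i \<in> X" if "i < length xs" for i using that set_xs nth_mem by blast
  have last: "last xs = x"
  proof -
    have last_nth: "last xs = xs ! (length xs - 1)" using ne by (simp add: last_conv_nth)
    obtain k where k: "k < length xs" "xs ! k = x" using top set_xs by (metis in_set_conv_nth)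
    have "\<not> k < length xs - 1"
    proof
      assume "k < length xs - 1"
      then have "f x < f (last xs)" using nth_less[of k "length xs - 1"] k last_nth ne by simp
      then show False
        using top(2)[of "last xs"] chain_le_iff[OF X(1)] top(1) set_xs ne
        by (metis last_in_set not_less)
    qed
    then have "k = length xs - 1" using k by linarith
    then show ?thesis using last_nth k by simp
  qed
  have minimal: "minimal_in S le (hd xs)"
  proof -
    have hd_X: "hd xs \<in> X" using ne set_xs hd_in_set by metis
    \<comment> \<open>Anything below the head is below the whole chain, so it already belongs to
      \<open>X\<close> by maximality and hence equals the head.\<close>
    have "y = hd xs" if y: "y \<in> S" "le y (hd xs)" for y
    proof -
      have hd_le: "le (hd xs) z" if z: "z \<in> X" for z
      proof -
        obtain k where "k < length xs" "xs ! k = z" using z set_xs by (metis in_set_conv_nth)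
        then have "f (hd xs) \<le> f z"
          using nth_less[of 0 k] ne by (cases "k = 0") (auto simp: hd_conv_nth)
        then show ?thesis using chain_le_iff[OF X(1)] hd_X z by blast
      qed
      then have "le y z" if "z \<in> X" for z
        using y that trans hd_X sub by blast
      then have "y \<in> X" using maximal_chain_no_insert[OF X y(1)] top(1) by blast
      then show ?thesis using hd_le y antisym hd_X sub by blast
    qed
    then show ?thesis using hd_X sub by (auto simp: minimal_in_def)
  qed
  have "direct_predecessor S le (xs ! i) (xs ! Suc i)" if i: "Suc i < length xs" for i
  proof -
    have iX: "xs ! i \<in> X" "xs ! Suc i \<in> X" using nth_in i by auto
    \<comment> \<open>An element strictly between two consecutive terms is comparable with the whole
      chain. Maximality puts it into \<open>X\<close>, but no member of \<open>X\<close> has a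
      length strictly between consecutive lengths.\<close>
    have False if z: "z \<in> S" "le (xs ! i) z" "xs ! i \<noteq> z" "le z (xs ! Suc i)" "z \<noteq> xs ! Suc i" for z
    proof -
      have fz: "f (xs ! i) < f z" "f z < f (xs ! Suc i)"
        using z strict_mono iX sub by (meson subsetD)+
      have cmp: "le y z \<or> le z y" if y: "y \<in> X" for y
      proof -
        obtain k where k: "k < length xs" "xs ! k = y" using y set_xs by (metis in_set_conv_nth)
        show ?thesis
        proof (cases "k \<le> i")
          case True
          then have "f y \<le> f (xs ! i)" using nth_less[of k i] k i by (cases "k = i") auto
          then have "le y (xs ! i)" using chain_le_iff[OF X(1)] y iX by blast
          then show ?thesis using trans z y iX sub by blast
        next
          case False
          then have "f (xs ! Suc i) \<le> f y"
            using nth_less[of "Suc i" k] k i by (cases "k = Suc i") auto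
          then have "le (xs ! Suc i) y" using chain_le_iff[OF X(1)] y iX by blast
          then show ?thesis using trans z y iX sub by blast
        qed
      qed
      have "le z x" using trans z iX top sub by blast
      then have "z \<in> X" using maximal_chain_no_insert[OF X z(1) cmp] by blast
      then obtain k where k: "k < length xs" "xs ! k = z" using set_xs by (metis in_set_conv_nth)
      show False
        using fz k i nth_less[of k i] nth_less[of "Suc i" k]
        by (metis not_less_iff_gr_or_eq not_less_eq Suc_lessD)
    qed
    moreover have "le (xs ! i) (xs ! Suc i)" "xs ! i \<noteq> xs ! Suc i"
      using sorted i by (auto simp: sorted_wrt_iff_nth_less)
    ultimately show ?thesis using iX sub by (auto simp: direct_predecessor_def)
  qed
  then have "filtration S le x X"
    unfolding filtration_def using ne set_xs sub sorted last minimal by blast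
  then show ?thesis using X(2) by (simp add: star_filtration_def)
qed

end

section \<open>Connectedness and cycles of the underlying graph\<close>

definition und :: "('a, 'b) pre_digraph \<Rightarrow> 'b set \<Rightarrow> 'a rel" where
  "und G A = {(u, v). \<exists>\<alpha>\<in>A. {tail G \<alpha>, head G \<alpha>} = {u, v}}"

lemma und_arcI:
  assumes "\<alpha> \<in> A"
  shows "(tail G \<alpha>, head G \<alpha>) \<in> und G A"
  using assms by (auto simp: und_def)

lemma sym_und: "sym (und G A)"
  by (auto simp: und_def sym_def insert_commute)

lemma und_rtrancl_sym: "(u, v) \<in> (und G A)\<^sup>* \<Longrightarrow> (v, u) \<in> (und G A)\<^sup>*"
  by (meson sym_und sym_rtrancl symE)

text \<open>The library calls a digraph connected if its symmetrisation is strongly connected; the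
  arcs of the symmetrisation are exactly the pairs in \<open>und\<close>.\<close>

lemma connected_iff_und:
  assumes "wf_digraph G"
  shows "Digraph_Component.connected G \<longleftrightarrow>
    verts G \<noteq> {} \<and> (\<forall>u\<in>verts G. \<forall>v\<in>verts G. (u, v) \<in> (und G (arcs G))\<^sup>*)"
proof -
  have und: "arcs_ends (with_proj (mk_symmetric G)) = und G (arcs G)"
    by (auto simp: parcs_mk_symmetric und_def doubleton_eq_iff arcs_ends_conv)
  interpret S: pair_wf_digraph "mk_symmetric G"
    using assms by (rule wf_digraph.wellformed_mk_symmetric)
  have "u \<rightarrow>\<^sup>*\<^bsub>mk_symmetric G\<^esub> v \<longleftrightarrow> (u, v) \<in> (und G (arcs G))\<^sup>*"
    if "u \<in> verts G" "v \<in> verts G" for u v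
  proof
    assume "u \<rightarrow>\<^sup>*\<^bsub>mk_symmetric G\<^esub> v"
    then show "(u, v) \<in> (und G (arcs G))\<^sup>*" using reachable_rtranclI und by metis
  next
    assume "(u, v) \<in> (und G (arcs G))\<^sup>*"
    then show "u \<rightarrow>\<^sup>*\<^bsub>mk_symmetric G\<^esub> v"
    proof (induction rule: rtrancl_induct)
      case base
      show ?case by (rule S.reachable_refl) (simp add: that)
    next
      case (step y z)
      show ?case by (rule S.reachable_adj_trans[OF step.IH]) (use und step.hyps in simp)
    qed
  qed
  then show ?thesis
    by (auto simp: connected_def strongly_connected_def)
qed

lemma connected_crossing:
  assumes "wf_digraph G" "Digraph_Component.connected G"
    and "a \<in> verts G" "a \<in> V" "b \<in> verts G" "b \<notin> V"
  shows "\<exists>\<alpha>\<in>arcs G. (tail G \<alpha> \<in> V) \<noteq> (head G \<alpha> \<in> V)"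
proof (rule ccontr)
  assume no: "\<not> ?thesis"
  have "(a, b) \<in> (und G (arcs G))\<^sup>*"
    using assms connected_iff_und by metis
  then have "b \<in> V"
  proof (induction rule: rtrancl_induct)
    case (step y z)
    then show ?case using no by (auto simp: und_def doubleton_eq_iff)
  qed (use assms in auto)
  then show False using assms by blast
qed

lemma connectedI:
  assumes "wf_digraph G" "verts G \<noteq> {}"
    and "\<And>V. \<lbrakk>V \<subseteq> verts G; V \<noteq> {}; V \<noteq> verts G\<rbrakk> \<Longrightarrow>
      \<exists>\<alpha>\<in>arcs G. (tail G \<alpha> \<in> V) \<noteq> (head G \<alpha> \<in> V)"
  shows "Digraph_Component.connected G"
  unfolding connected_iff_und[OF assms(1)]
proof (intro conjI ballI)
  fix u v assume u: "u \<in> verts G" and v: "v \<in> verts G"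
  define V where "V = {z \<in> verts G. (u, z) \<in> (und G (arcs G))\<^sup>*}"
  have "V = verts G"
  proof (rule ccontr)
    assume "V \<noteq> verts G"
    moreover have "V \<subseteq> verts G" "V \<noteq> {}" using u by (auto simp: V_def)
    ultimately obtain \<alpha> where \<alpha>: "\<alpha> \<in> arcs G" "(tail G \<alpha> \<in> V) \<noteq> (head G \<alpha> \<in> V)"
      using assms(3) by meson
    have "(tail G \<alpha>, head G \<alpha>) \<in> und G (arcs G)" "(head G \<alpha>, tail G \<alpha>) \<in> und G (arcs G)"
      using \<alpha>(1) und_arcI sym_und symE by metis+
    moreover have "tail G \<alpha> \<in> verts G" "head G \<alpha> \<in> verts G"
      using \<alpha>(1) assms(1) by (auto simp: wf_digraph_def)
    ultimately show False
      using \<alpha>(2) unfolding V_def by (auto intro: rtrancl_into_rtrancl)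
  qed
  then show "(u, v) \<in> (und G (arcs G))\<^sup>*" using v unfolding V_def by blast
qed (rule assms(2))

text \<open>A walk of least length cannot repeat a vertex, because cutting out the part between two
  visits would shorten it.\<close>

lemma rtrancl_simple_path:
  assumes "(u, v) \<in> r\<^sup>*"
  obtains n f where "f 0 = u" "f n = v" "\<And>i. i < n \<Longrightarrow> (f i, f (Suc i)) \<in> r" "inj_on f {..n}"
proof -
  define n where "n = (LEAST n. (u, v) \<in> r ^^ n)"
  have n: "(u, v) \<in> r ^^ n"
    using rtrancl_imp_relpow[OF assms] unfolding n_def by (auto intro: LeastI)
  have min: "n \<le> m" if "(u, v) \<in> r ^^ m" for m
    unfolding n_def using that by (rule Least_le)
  obtain f where f: "f 0 = u" "f n = v" "\<And>i. i < n \<Longrightarrow> (f i, f (Suc i)) \<in> r"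
    using n unfolding relpow_fun_conv by blast
  have "f i \<noteq> f j" if ij: "i < j" "j \<le> n" for i j
  proof
    assume eq: "f i = f j"
    have "(u, f i) \<in> r ^^ i" unfolding relpow_fun_conv using f ij by (intro exI[of _ f]) auto
    moreover have "(f j, v) \<in> r ^^ (n - j)"
      unfolding relpow_fun_conv using f ij by (intro exI[of _ "\<lambda>k. f (j + k)"]) auto
    ultimately have "(u, v) \<in> r ^^ (i + (n - j))"
      unfolding relpow_add eq by blast
    then show False using min ij by fastforce
  qed
  then have "inj_on f {..n}" by (auto intro: linorder_inj_onI)
  with f that show thesis by blast
qed

text \<open>A simple path through arrows of \<open>A\<close> is closed up by the arrow outside
  \<open>A\<close>. The set \<open>V\<close> keeps track of where the cycle lies; later it is the
  vertex set of a subquiver.\<close>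

lemma underlying_cycle_of_path_and_arc:
  assumes wf: "wf_digraph G" and sub: "A \<subseteq> arcs G" and \<alpha>: "\<alpha> \<in> arcs G - A" "tail G \<alpha> \<noteq> head G \<alpha>"
    and path: "(tail G \<alpha>, head G \<alpha>) \<in> (und G A)\<^sup>*"
    and V: "\<And>\<beta>. \<beta> \<in> insert \<alpha> A \<Longrightarrow> tail G \<beta> \<in> V \<and> head G \<beta> \<in> V"
  obtains C where "subgraph C G" "underlying_cycle C" "verts C \<subseteq> V"
proof -
  obtain n f where f: "f 0 = tail G \<alpha>" "f n = head G \<alpha>" "inj_on f {..n}"
      "\<And>i. i < n \<Longrightarrow> (f i, f (Suc i)) \<in> und G A"
    using rtrancl_simple_path[OF path] by metis
  have n: "n > 0" using f(1,2) \<alpha>(2) by (cases n) auto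
  have "\<forall>i. \<exists>\<beta>. i < n \<longrightarrow> \<beta> \<in> A \<and> {tail G \<beta>, head G \<beta>} = {f i, f (Suc i)}"
    using f(4) by (auto simp: und_def)
  then obtain e where e: "\<And>i. i < n \<Longrightarrow> e i \<in> A"
      "\<And>i. i < n \<Longrightarrow> {tail G (e i), head G (e i)} = {f i, f (Suc i)}"
    by metis
  \<comment> \<open>Index \<open>n\<close> belongs to the closing arrow, which joins
    \<open>f n\<close> back to \<open>f 0\<close>, in accordance with
    \<open>Suc n mod Suc n = 0\<close>.\<close>
  define e' where "e' = (\<lambda>i. if i < n then e i else \<alpha>)"
  define C where "C = \<lparr>verts = f ` {..n}, arcs = e' ` {..n}, tail = tail G, head = head G\<rparr>"
  have ends: "{tail G (e' i), head G (e' i)} = {f i, f (Suc i mod Suc n)}" if "i \<le> n" for i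
    using that e(2)[of i] f(1,2) by (cases "i < n") (auto simp: e'_def)
  have e'_arcs: "e' i \<in> insert \<alpha> A" for i using e(1) by (simp add: e'_def)
  \<comment> \<open>If an arrow occurred at two positions, \<open>f i\<close> would be an end of the
    later edge, although both ends of that edge have indices larger than \<open>i\<close>.\<close>
  have inj_e: "e i \<noteq> e j" if ij: "i < j" "j < n" for i j
  proof
    assume "e i = e j"
    then have "f i \<in> {f j, f (Suc j)}" using e(2) ij by (metis insertI1 less_trans)
    moreover have "f i \<noteq> f j" "f i \<noteq> f (Suc j)"
      using f(3) ij inj_on_eq_iff[OF f(3), of i] by auto
    ultimately show False by blast
  qed
  have "inj_on e' {..n}"
  proof (rule linorder_inj_onI)
    fix i j assume "i < j" "i \<in> {..n}" "j \<in> {..n}"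
    then show "e' i \<noteq> e' j"
      using inj_e[of i j] e(1)[of i] \<alpha>(1) by (auto simp: e'_def)
  qed auto
  then have bij: "bij_betw f {..n} (verts C)" "bij_betw e' {..n} (arcs C)"
    using f(3) by (auto simp: C_def bij_betw_def)
  have in_V: "f i \<in> V" if "i \<le> n" for i
    using ends[OF that] V[OF e'_arcs[of i]] by (metis empty_iff insert_iff)
  have "wf_digraph C"
  proof
    fix \<beta> assume "\<beta> \<in> arcs C"
    then obtain i where i: "i \<le> n" "\<beta> = e' i" by (auto simp: C_def)
    have "Suc i mod Suc n \<le> n" using mod_less_divisor[of "Suc n"] by (simp add: less_Suc_eq_le)
    then have "{tail G \<beta>, head G \<beta>} \<subseteq> f ` {..n}" using ends[OF i(1)] i by auto
    then show "tail C \<beta> \<in> verts C" "head C \<beta> \<in> verts C" by (auto simp: C_def)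
  qed
  moreover have "arcs C \<subseteq> arcs G" using e'_arcs sub \<alpha>(1) unfolding C_def by fastforce
  moreover have "verts C \<subseteq> verts G"
  proof
    fix a assume "a \<in> verts C"
    then obtain i where i: "i \<le> n" "a = f i" by (auto simp: C_def)
    have "e' i \<in> arcs G" using e'_arcs[of i] sub \<alpha>(1) by auto
    then have "{tail G (e' i), head G (e' i)} \<subseteq> verts G" using wf by (auto simp: wf_digraph_def)
    then show "a \<in> verts G" using ends[OF i(1)] i(2) by auto
  qed
  ultimately have "subgraph C G"
    using wf by (auto simp: subgraph_def compatible_def C_def)
  moreover have "underlying_cycle C"
    unfolding underlying_cycle_def using n bij ends by (intro exI conjI) (auto simp: C_def)
  moreover have "verts C \<subseteq> V" using in_V by (auto simp: C_def)
  ultimately show thesis using that by blast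
qed

lemma underlying_cycle_connected:
  assumes "wf_digraph G" "underlying_cycle G"
  shows "Digraph_Component.connected G"
proof -
  obtain n v e where n: "n > 0" and v: "bij_betw v {..n} (verts G)" and e: "bij_betw e {..n} (arcs G)"
      and ends: "\<And>i. i \<le> n \<Longrightarrow> {tail G (e i), head G (e i)} = {v i, v (Suc i mod Suc n)}"
    using assms(2) unfolding underlying_cycle_def by blast
  have verts: "verts G = v ` {..n}" using v by (simp add: bij_betw_def)
  have "(v 0, v i) \<in> (und G (arcs G))\<^sup>*" if "i \<le> n" for i
    using that
  proof (induction i)
    case (Suc i)
    have "e i \<in> arcs G" using e Suc.prems by (auto simp: bij_betw_def)
    then have "(v i, v (Suc i)) \<in> und G (arcs G)"
      using ends[of i] Suc.prems by (auto simp: und_def)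
    then show ?case using Suc by auto
  qed auto
  then have "(v i, v j) \<in> (und G (arcs G))\<^sup>*" if "i \<le> n" "j \<le> n" for i j
    using that und_rtrancl_sym by (metis rtrancl_trans)
  then show ?thesis unfolding connected_iff_und[OF assms(1)] verts by auto
qed

text \<open>
  A cycle has as many arcs as vertices, so a cycle inside it contains, with each vertex, the
  arc to the cyclically next one.
\<close>

lemma underlying_cycle_in_cycle:
  assumes "underlying_cycle G" "underlying_cycle C" "subgraph C G"
  shows "verts C = verts G"
proof -
  obtain n v e where n: "n > 0" and v: "bij_betw v {..n} (verts G)" and e: "bij_betw e {..n} (arcs G)"
      and ends: "\<And>i. i \<le> n \<Longrightarrow> {tail G (e i), head G (e i)} = {v i, v (Suc i mod Suc n)}"
    using assms(1) unfolding underlying_cycle_def by blast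
  obtain m v' e' where m: "bij_betw v' {..m} (verts C)" "bij_betw e' {..m::nat} (arcs C)"
    using assms(2) unfolding underlying_cycle_def by blast
  \<comment> \<open>\<open>I\<close> and \<open>J\<close> are the positions on the big cycle of the
    vertices and of the arrows of \<open>C\<close>. Each arrow brings its two ends along; equal
    cardinalities then force \<open>J = I\<close>.\<close>
  define I where "I = {i. i \<le> n \<and> v i \<in> verts C}"
  define J where "J = {i. i \<le> n \<and> e i \<in> arcs C}"
  have sub: "verts C \<subseteq> verts G" "arcs C \<subseteq> arcs G" "wf_digraph C" "tail C = tail G" "head C = head G"
    using assms(3) by (auto simp: subgraph_def compatible_def)
  have next_J: "v i \<in> verts C" "v (Suc i mod Suc n) \<in> verts C" if "i \<in> J" for i
  proof -
    have "i \<le> n" "e i \<in> arcs C" using that by (auto simp: J_def)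
    then have "{tail G (e i), head G (e i)} \<subseteq> verts C"
      using sub by (auto simp: wf_digraph_def)
    then show "v i \<in> verts C" "v (Suc i mod Suc n) \<in> verts C"
      using ends[OF \<open>i \<le> n\<close>] by auto
  qed
  have "J \<subseteq> I" using next_J by (auto simp: I_def J_def)
  moreover have "card J = card I"
  proof -
    have "bij_betw v I (verts C)" "bij_betw e J (arcs C)"
      using v e sub by (auto simp: bij_betw_def I_def J_def inj_on_def image_iff)
    then show ?thesis using m by (metis bij_betw_same_card)
  qed
  moreover have "finite I" by (simp add: I_def)
  ultimately have IJ: "J = I" by (metis card_subset_eq)
  have step: "Suc i mod Suc n \<in> I" if "i \<in> I" for i
  proof -
    have "Suc i mod Suc n \<le> n" using mod_less_divisor[of "Suc n"] less_Suc_eq_le by blast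
    then show ?thesis using next_J(2)[of i] that unfolding IJ unfolding I_def by blast
  qed
  have "v' 0 \<in> verts C" using m(1) by (auto simp: bij_betw_def)
  moreover have verts: "verts G = v ` {..n}" using v by (simp add: bij_betw_def)
  ultimately have "\<exists>i. i \<in> I" using sub(1) unfolding I_def by force
  then obtain i where i: "i \<in> I" ..
  \<comment> \<open>Repeated steps to the next position run once around the cycle. The offset
    \<open>Suc n - i + j\<close> used below leads from \<open>i\<close> to \<open>j\<close> without
    truncated subtraction, as \<open>i\<close> is at most \<open>n\<close>.\<close>
  have "(i + k) mod Suc n \<in> I" for k
  proof (induction k)
    case 0
    have "i mod Suc n = i" using i by (simp add: I_def)
    then show ?case using i by simp
  next
    case (Suc k)
    show ?case using step[OF Suc] by (simp only: mod_Suc_eq add_Suc_right)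
  qed
  note shift = this
  have "j \<in> I" if "j \<le> n" for j
  proof -
    have "i \<le> n" using i by (simp add: I_def)
    then have "i + (Suc n - i + j) = Suc n + j" by linarith
    moreover have "(Suc n + j) mod Suc n = j"
      using that by (simp only: mod_add_self1) simp
    ultimately show ?thesis using shift[of "Suc n - i + j"] by (simp only:)
  qed
  then have "verts G \<subseteq> verts C" unfolding verts by (auto simp: I_def)
  then show ?thesis using sub by blast
qed

section \<open>Acyclicity and sources\<close>

lemma acyclic_arcs_ends:
  assumes "acyclic_quiver Q"
  shows "acyclic (arcs_ends Q)"
proof (rule acyclicI, rule allI, rule notI)
  fix u assume u: "(u, u) \<in> (arcs_ends Q)\<^sup>+"
  interpret fin_digraph Q using assms by (simp add: acyclic_quiver_def quiver_def)
  obtain p where "awalk u p u" "p \<noteq> []" using u reachable1_awalk by blast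
  then have "closed_w p" by (auto simp: closed_w_def)
  then show False using closed_w_imp_cycle assms by (auto simp: acyclic_quiver_def)
qed

text \<open>A finite acyclic relation is well-founded, so \<open>V\<close> has a minimal element.
  Such a source can be split off as a simple quotient, which drives the computation of
  lengths.\<close>

lemma exists_source:
  assumes "acyclic_quiver Q" "A \<subseteq> arcs Q" "V \<noteq> {}"
  obtains a where "a \<in> V" "\<And>\<alpha>. \<alpha> \<in> A \<Longrightarrow> head Q \<alpha> = a \<Longrightarrow> tail Q \<alpha> \<notin> V"
proof -
  have "finite (arcs_ends Q)"
    using assms(1) by (auto simp: acyclic_quiver_def quiver_def fin_digraph_def
        fin_digraph_axioms_def arcs_ends_conv)
  then have "wf (arcs_ends Q)" using acyclic_arcs_ends[OF assms(1)] by (rule finite_acyclic_wf)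
  then obtain a where "a \<in> V" "\<And>y. (y, a) \<in> arcs_ends Q \<Longrightarrow> y \<notin> V"
    using assms(3) by (metis wf_eq_minimal ex_in_conv)
  then show thesis using assms(2) by (intro that) (auto simp: arcs_ends_conv)
qed

section \<open>Thin representations\<close>

subsection \<open>Lines\<close>

lemma linear_on_zero:
  assumes "seqs.subspace U" "linear_on U V f"
  shows "f 0 = 0"
proof -
  have "f (seq_scale 0 0) = seq_scale 0 (f 0)"
    using assms seqs.subspace_0 unfolding linear_on_def by blast
  then show ?thesis by simp
qed

lemma finite_dim_subspace_0: "finite_dim_subspace {0}"
  unfolding finite_dim_subspace_def
  by (metis finite.emptyI seqs.span_empty seqs.subspace_single_0)

lemma finite_dim_subspace_span: "finite B \<Longrightarrow> finite_dim_subspace (seqs.span B)"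
  unfolding finite_dim_subspace_def by auto

lemma span_of_dim_le_1:
  assumes "finite_dim_subspace V" "seqs.dim V \<le> 1" "x \<in> V" "x \<noteq> 0"
  shows "V = seqs.span {x}"
proof
  have V: "seqs.subspace V" using assms(1) by (simp add: finite_dim_subspace_def)
  show "seqs.span {x} \<subseteq> V" using V assms(3) by (intro seqs.span_minimal) auto
  obtain B where B: "B \<subseteq> V" "seqs.independent B" "V \<subseteq> seqs.span B" "card B = seqs.dim V"
    using seqs.basis_exists by blast
  \<comment> \<open>All spaces sit inside an infinite-dimensional one and \<open>card\<close> is 0
    on infinite sets, so the finiteness of the basis has to be established before its size is
    determined to be 1.\<close>
  have "finite B"
    using assms(1) B(1,2) seqs.independent_span_bound unfolding finite_dim_subspace_def by blast
  moreover have "B \<noteq> {}" using assms(3,4) B(3) by auto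
  ultimately have "card B = 1" using B(4) assms(2) by (metis card_0_eq le_neq_implies_less less_one)
  then obtain b where b: "B = {b}" by (auto simp: card_1_singleton_iff)
  then obtain c where c: "x = seq_scale c b"
    using B(3) assms(3) by (auto simp: seqs.span_singleton)
  then have "c \<noteq> 0" using assms(4) by auto
  then have "b = seq_scale (inverse c) x" using c by simp
  then have "b \<in> seqs.span {x}" by (auto simp: seqs.span_singleton)
  then have "seqs.span B \<subseteq> seqs.span {x}" unfolding b by (intro seqs.span_minimal) auto
  then show "V \<subseteq> seqs.span {x}" using B(3) by blast
qed

text \<open>For nonzero \<open>x\<close> this is the linear map on the span of \<open>x\<close> that
  sends \<open>x\<close> to \<open>y\<close>. The coordinate is then unique; off that span the value
  is unspecified.\<close>

definition line_map :: "'k::field seq \<Rightarrow> 'k seq \<Rightarrow> 'k seq \<Rightarrow> 'k seq" where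
  "line_map x y v = seq_scale (THE c. v = seq_scale c x) y"

lemma line_map_scale [simp]: "x \<noteq> 0 \<Longrightarrow> line_map x y (seq_scale c x) = seq_scale c y"
  unfolding line_map_def by simp

lemma line_map_0: "x \<noteq> 0 \<Longrightarrow> line_map x y 0 = 0"
  using line_map_scale[of x y 0] by simp

lemma linear_on_line_map:
  assumes "x \<noteq> 0"
  shows "linear_on (seqs.span {x}) (seqs.span {y}) (line_map x y)"
  using assms
  by (auto simp: linear_on_def seqs.span_singleton simp flip: seqs.scale_left_distrib)

lemma bij_betw_line_map:
  assumes "x \<noteq> 0" "y \<noteq> 0"
  shows "bij_betw (line_map x y) (seqs.span {x}) (seqs.span {y})"
  using assms by (intro bij_betwI[where g = "line_map y x"]) (auto simp: seqs.span_singleton)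

definition unit_seq :: "'k::field seq" where
  "unit_seq = (\<lambda>n. if n = 0 then 1 else 0)"

lemma unit_seq_nonzero: "unit_seq \<noteq> 0"
  by (auto simp: unit_seq_def fun_eq_iff)

lemma unit_line_eq: "unit_line = seqs.span {unit_seq}"
  by (simp add: unit_line_def unit_seq_def)

lemma simple_rep_representation:
  assumes "i \<in> verts Q"
  shows "representation Q (simple_rep i)"
  using assms seqs.span_zero
  by (auto simp: representation_def simple_rep_def linear_on_def finite_dim_subspace_0
      finite_dim_subspace_span unit_line_eq)

lemma simple_rep_nonzero:
  assumes "i \<in> verts Q"
  shows "\<not> zero_rep Q (simple_rep i)"
  using assms unit_seq_nonzero seqs.span_base[of unit_seq "{unit_seq}"]
  by (force simp: zero_rep_def simple_rep_def unit_line_eq)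

subsection \<open>Subrepresentations of thin representations\<close>

lemma rep_subspace:
  assumes "representation Q X"
  shows "seqs.subspace (rspace X a)"
  using assms by (cases "a \<in> verts Q") (auto simp: representation_def finite_dim_subspace_def)

lemma rep_zero_in: "representation Q X \<Longrightarrow> 0 \<in> rspace X a"
  by (rule seqs.subspace_0[OF rep_subspace])

lemma rep_nonzero_iff: "representation Q X \<Longrightarrow> rspace X a \<noteq> {0} \<longleftrightarrow> (\<exists>x\<in>rspace X a. x \<noteq> 0)"
  using rep_zero_in[of Q X a] by auto

lemma rep_rmap_0:
  assumes "representation Q X"
  shows "rmap X \<alpha> 0 = 0"
proof (cases "\<alpha> \<in> arcs Q")
  case True
  then show ?thesis
    using assms linear_on_zero[OF rep_subspace[OF assms]] unfolding representation_def by blast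
next
  case False
  then show ?thesis using assms unfolding representation_def by blast
qed

lemma rep_rmap_in:
  "\<lbrakk>representation Q X; \<alpha> \<in> arcs Q; v \<in> rspace X (tail Q \<alpha>)\<rbrakk> \<Longrightarrow> rmap X \<alpha> v \<in> rspace X (head Q \<alpha>)"
  unfolding representation_def linear_on_def by blast

lemma rep_rmap_scale:
  "\<lbrakk>representation Q X; \<alpha> \<in> arcs Q; v \<in> rspace X (tail Q \<alpha>)\<rbrakk>
    \<Longrightarrow> rmap X \<alpha> (seq_scale c v) = seq_scale c (rmap X \<alpha> v)"
  unfolding representation_def linear_on_def by blast

lemma supp_simps [simp]:
  "tail (supp Q X) = tail Q" "head (supp Q X) = head Q"
  "verts (supp Q X) = {a \<in> verts Q. rspace X a \<noteq> {0}}"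
  by (simp_all add: supp_def)

text \<open>Structural maps vanish by convention outside their domains, so a nonzero value anywhere
  already places the arrow in the support.\<close>

lemma arcs_supp_iff:
  assumes "representation Q X"
  shows "\<alpha> \<in> arcs (supp Q X) \<longleftrightarrow> (\<exists>v. rmap X \<alpha> v \<noteq> 0)"
  using assms unfolding supp_def representation_def by (simp, blast)

lemma wf_supp:
  assumes "wf_digraph Q" "representation Q X"
  shows "wf_digraph (supp Q X)"
proof
  fix \<alpha> assume "\<alpha> \<in> arcs (supp Q X)"
  then obtain v where \<alpha>: "\<alpha> \<in> arcs Q" and v: "v \<in> rspace X (tail Q \<alpha>)" "rmap X \<alpha> v \<noteq> 0"
    by (auto simp: supp_def)
  have "v \<noteq> 0" using v(2) rep_rmap_0[OF assms(2)] by metis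
  moreover have "rmap X \<alpha> v \<in> rspace X (head Q \<alpha>)"
    using rep_rmap_in[OF assms(2) \<alpha> v(1)] .
  ultimately show "tail (supp Q X) \<alpha> \<in> verts (supp Q X)" "head (supp Q X) \<alpha> \<in> verts (supp Q X)"
    using v \<alpha> assms(1) by (auto simp: wf_digraph_def)
qed

lemma subgraph_supp:
  assumes "wf_digraph Q" "representation Q X"
  shows "subgraph (supp Q X) Q"
  using assms wf_supp[OF assms] by (auto simp: subgraph_def compatible_def supp_def)

lemma subrep_trans:
  assumes "wf_digraph Q" "subrep Q X Y" "subrep Q Y Z"
  shows "subrep Q X Z"
proof -
  have "rmap X \<alpha> v = rmap Z \<alpha> v" if "\<alpha> \<in> arcs Q" "v \<in> rspace X (tail Q \<alpha>)" for \<alpha> v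
  proof -
    have "tail Q \<alpha> \<in> verts Q" using that assms(1) by (simp add: wf_digraph_def)
    then have "v \<in> rspace Y (tail Q \<alpha>)" using that assms(2) by (auto simp: subrep_def)
    then show ?thesis using that assms(2,3) by (simp add: subrep_def)
  qed
  then show ?thesis using assms(2,3) unfolding subrep_def by blast
qed

section \<open>Closed vertex sets and subrepresentations\<close>

locale thin_representation =
  fixes Q :: "('a, 'b) pre_digraph" and M :: "('a, 'b, 'k::field) qrep"
  assumes acyclic: "acyclic_quiver Q"
    and rep: "representation Q M"
    and thin: "thin Q M"
begin

abbreviation "T \<equiv> supp Q M"

text \<open>The vertex sets closed under successors in the support are those of subrepresentations.\<close>

definition closed :: "'a set \<Rightarrow> bool" where
  "closed V \<longleftrightarrow> V \<subseteq> verts T \<and> (\<forall>\<alpha>\<in>arcs T. tail Q \<alpha> \<in> V \<longrightarrow> head Q \<alpha> \<in> V)"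

text \<open>\<open>restrict_rep\<close> as a function of a vertex set alone: subquivers with the
  same vertices, such as a cycle and the cycle without one arrow, give the same
  subrepresentation.\<close>

definition sub :: "'a set \<Rightarrow> ('a, 'b, 'k) qrep" where
  "sub V = \<lparr>rspace = (\<lambda>a. if a \<in> V then rspace M a else {0}),
            rmap = (\<lambda>\<alpha> v. if tail Q \<alpha> \<in> V then rmap M \<alpha> v else 0)\<rparr>"

lemma restrict_rep_eq_sub: "restrict_rep Q M R = sub (verts R)"
  by (simp add: restrict_rep_def sub_def)

lemma sub_simps [simp]:
  "rspace (sub V) a = (if a \<in> V then rspace M a else {0})"
  "rmap (sub V) \<alpha> v = (if tail Q \<alpha> \<in> V then rmap M \<alpha> v else 0)"
  by (simp_all add: sub_def)

lemma wf: "wf_digraph Q"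
  using acyclic by (simp add: acyclic_quiver_def quiver_def fin_digraph_def)

lemma finite_verts: "finite (verts Q)" and finite_arcs: "finite (arcs Q)"
  using acyclic by (simp_all add: acyclic_quiver_def quiver_def fin_digraph_def fin_digraph_axioms_def)

lemma arcs_T: "arcs T \<subseteq> arcs Q"
  by (auto simp: supp_def)

lemma wf_T: "\<alpha> \<in> arcs T \<Longrightarrow> tail Q \<alpha> \<in> verts T" "\<alpha> \<in> arcs T \<Longrightarrow> head Q \<alpha> \<in> verts T"
  using wf_supp[OF wf rep] unfolding wf_digraph_def supp_simps(1,2) by blast+

lemma no_loops: "\<alpha> \<in> arcs Q \<Longrightarrow> tail Q \<alpha> \<noteq> head Q \<alpha>"
  using acyclic_arcs_ends[OF acyclic] unfolding arcs_ends_conv acyclic_def by force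

lemma rspace_line:
  assumes "x \<in> rspace M a" "x \<noteq> 0"
  shows "rspace M a = seqs.span {x}"
proof -
  have "a \<in> verts Q" using assms rep by (auto simp: representation_def)
  then show ?thesis
    using assms rep thin by (intro span_of_dim_le_1) (auto simp: representation_def thin_def)
qed

lemmas rmap_in = rep_rmap_in[OF rep] and rmap_scale = rep_rmap_scale[OF rep]

lemma rmap_eq_0: "\<alpha> \<notin> arcs T \<Longrightarrow> rmap M \<alpha> v = 0"
  using arcs_supp_iff[OF rep] by blast

text \<open>The space at the tail is a line, so a linear map that kills one nonzero vector is zero,
  whereas arrows of the support carry nonzero maps.\<close>

lemma rmap_neq_0:
  assumes "\<alpha> \<in> arcs T" "x \<in> rspace M (tail Q \<alpha>)" "x \<noteq> 0"
  shows "rmap M \<alpha> x \<noteq> 0"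
proof
  assume 0: "rmap M \<alpha> x = 0"
  obtain v where \<alpha>: "\<alpha> \<in> arcs Q" and v: "v \<in> rspace M (tail Q \<alpha>)" "rmap M \<alpha> v \<noteq> 0"
    using assms(1) by (auto simp: supp_def)
  obtain c where "v = seq_scale c x"
    using v(1) rspace_line[OF assms(2,3)] by (auto simp: seqs.span_singleton)
  then show False using v(2) 0 rmap_scale[OF \<alpha> assms(2)] by simp
qed

lemma sub_representation:
  assumes "closed V"
  shows "representation Q (sub V)"
proof -
  have "rmap M \<alpha> v = 0" if "tail Q \<alpha> \<in> V" "head Q \<alpha> \<notin> V" for \<alpha> v
    using that assms rmap_eq_0 unfolding closed_def by blast
  moreover have "V \<subseteq> verts Q" using assms by (auto simp: closed_def)
  ultimately show ?thesis
    using rep rep_rmap_0[OF rep] finite_dim_subspace_0 rep_zero_in[OF rep]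
    unfolding representation_def linear_on_def sub_simps
    by auto
qed

lemma sub_subrep:
  assumes "closed V" "closed W" "V \<subseteq> W"
  shows "subrep Q (sub V) (sub W)"
  using assms sub_representation rep_zero_in[OF rep] rep_rmap_0[OF rep]
  by (auto simp: subrep_def)

lemma closed_T: "closed (verts T)"
  using wf_T unfolding closed_def by blast

lemma verts_supp_sub:
  assumes "closed V"
  shows "verts (supp Q (sub V)) = V"
  using assms by (auto simp: closed_def)

lemma arcs_supp_sub:
  assumes "closed V"
  shows "arcs (supp Q (sub V)) = {\<alpha> \<in> arcs T. tail Q \<alpha> \<in> V}"
  unfolding set_eq_iff arcs_supp_iff[OF sub_representation[OF assms]]
  by (auto simp: arcs_supp_iff[OF rep])

lemma sub_T: "sub (verts T) = M"
proof -
  have "rspace (sub (verts T)) = rspace M"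
    using rep by (auto simp: representation_def fun_eq_iff)
  moreover have "rmap (sub (verts T)) = rmap M"
    using rmap_eq_0 wf_T(1) by (force simp: fun_eq_iff simp del: supp_simps(3))
  ultimately show ?thesis by simp
qed

text \<open>A line has no subspaces besides zero and itself, so \<open>N\<close> is determined by
  the vertices of its support. That set is closed because arrows of the support of \<open>M\<close>
  act injectively.\<close>

lemma subrep_M_obtain:
  assumes "subrep Q N M"
  obtains V where "closed V" "N = sub V"
proof -
  have N: "representation Q N" and sub: "\<And>a. rspace N a \<subseteq> rspace M a"
    and map: "\<And>\<alpha> v. \<lbrakk>\<alpha> \<in> arcs Q; v \<in> rspace N (tail Q \<alpha>)\<rbrakk> \<Longrightarrow> rmap N \<alpha> v = rmap M \<alpha> v"
    using assms rep by (auto simp: subrep_def representation_def)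
  define V where "V = verts (supp Q N)"
  have zero: "rspace N a = {0}" if "a \<notin> V" for a
    using that N unfolding V_def by (auto simp: representation_def)
  have full: "rspace N a = rspace M a" if a: "a \<in> V" for a
  proof -
    obtain x where x: "x \<in> rspace N a" "x \<noteq> 0"
      using a rep_nonzero_iff[OF N] by (auto simp: V_def)
    have "rspace M a = seqs.span {x}" using rspace_line x sub by blast
    also have "\<dots> \<subseteq> rspace N a" using x rep_subspace[OF N] by (intro seqs.span_minimal) auto
    finally show ?thesis using sub by blast
  qed
  have "closed V"
    unfolding closed_def
  proof (intro conjI ballI impI)
    show "V \<subseteq> verts T" using full by (auto simp: V_def)
    fix \<alpha> assume \<alpha>: "\<alpha> \<in> arcs T" "tail Q \<alpha> \<in> V"
    have \<alpha>Q: "\<alpha> \<in> arcs Q" using \<alpha> arcs_T by blast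
    obtain x where x: "x \<in> rspace N (tail Q \<alpha>)" "x \<noteq> 0"
      using \<alpha> rep_nonzero_iff[OF N] by (auto simp: V_def)
    have "rmap N \<alpha> x \<in> rspace N (head Q \<alpha>)"
      using rep_rmap_in[OF N \<alpha>Q x(1)] .
    moreover have "rmap N \<alpha> x \<noteq> 0" using map[OF \<alpha>Q x(1)] rmap_neq_0[OF \<alpha>(1)] x sub by auto
    ultimately show "head Q \<alpha> \<in> V" using zero by blast
  qed
  moreover have "N = sub V"
  proof -
    have "rspace N = rspace (sub V)" by (rule ext) (simp add: zero full)
    moreover have "rmap N \<alpha> v = rmap (sub V) \<alpha> v" for \<alpha> v
    proof (cases "\<alpha> \<in> arcs Q \<and> v \<in> rspace N (tail Q \<alpha>)")
      case True
      then show ?thesis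
        using map zero[of "tail Q \<alpha>"] rep_rmap_0[OF rep] by auto
    next
      case False
      then show ?thesis
        using N rep full[of "tail Q \<alpha>"] by (auto simp: representation_def)
    qed
    then have "rmap N = rmap (sub V)" by (metis ext)
    ultimately show ?thesis by simp
  qed
  ultimately show thesis using that by blast
qed

lemma sub_subrep_iff:
  assumes "closed V" "closed W"
  shows "subrep Q (sub V) (sub W) \<longleftrightarrow> V \<subseteq> W"
proof
  assume "subrep Q (sub V) (sub W)"
  then have "rspace (sub V) a \<subseteq> rspace (sub W) a" if "a \<in> verts Q" for a
    using that unfolding subrep_def by blast
  moreover have "V \<subseteq> verts Q" "\<And>a. a \<in> V \<Longrightarrow> rspace M a \<noteq> {0}"
    using assms by (auto simp: closed_def)
  ultimately show "V \<subseteq> W" using rep_zero_in[OF rep] by fastforce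
qed (use assms sub_subrep in blast)

lemma sub_subrep_M: "closed V \<Longrightarrow> subrep Q (sub V) M"
  using sub_subrep[of V "verts T"] closed_T unfolding sub_T closed_def by blast

lemma zero_rep_sub_iff:
  assumes "closed V"
  shows "zero_rep Q (sub V) \<longleftrightarrow> V = {}"
proof -
  have "zero_rep Q (sub V) \<longleftrightarrow> verts (supp Q (sub V)) = {}"
    unfolding zero_rep_def supp_simps by blast
  then show ?thesis unfolding verts_supp_sub[OF assms] .
qed

text \<open>A nontrivial decomposition would split the vertices into two nonempty disjoint closed
  sets. By connectedness some arrow of \<open>R\<close> joins them, and closedness forces its head
  into both.\<close>

lemma indecomposable_sub:
  assumes R: "subgraph R T" "Digraph_Component.connected R" and V: "closed (verts R)"
  shows "indecomposable Q (sub (verts R))"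
proof -
  have wfR: "wf_digraph R" and arcsR: "arcs R \<subseteq> arcs T" "tail R = tail Q" "head R = head Q"
    using R(1) by (auto simp: subgraph_def compatible_def)
  have "verts R \<noteq> {}" using R(2) connected_iff_und[OF wfR] by blast
  then have "\<not> zero_rep Q (sub (verts R))" using zero_rep_sub_iff[OF V] by blast
  moreover have "zero_rep Q U \<or> zero_rep Q W" if UW: "direct_sum_of Q (sub (verts R)) U W" for U W
  proof -
    have sr: "subrep Q U (sub (verts R))" "subrep Q W (sub (verts R))"
      using UW by (auto simp: direct_sum_of_def)
    note summands = bspec[OF UW[unfolded direct_sum_of_def, THEN conjunct2, THEN conjunct2]]
    have "subrep Q U M" "subrep Q W M"
      using sr sub_subrep_M[OF V] subrep_trans[OF wf] by blast+
    then obtain A B where A: "closed A" "U = sub A" and B: "closed B" "W = sub B"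
      by (metis subrep_M_obtain)
    have AB: "A \<subseteq> verts R" "B \<subseteq> verts R" using sr A B V sub_subrep_iff by blast+
    have nz: "\<And>a. a \<in> verts R \<Longrightarrow> a \<in> verts Q \<and> rspace M a \<noteq> {0}"
      using V by (auto simp: closed_def)
    have disj: "A \<inter> B = {}"
    proof (rule ccontr)
      assume "A \<inter> B \<noteq> {}"
      then obtain a where a: "a \<in> A" "a \<in> B" by blast
      then have aR: "a \<in> verts Q" "rspace M a \<noteq> {0}" using AB nz by blast+
      have "rspace U a = rspace M a" "rspace W a = rspace M a" using a A(2) B(2) by simp_all
      then show False using summands[OF aR(1)] aR(2) by simp
    qed
    have cover: "verts R \<subseteq> A \<union> B"
    proof
      fix a assume a: "a \<in> verts R"
      show "a \<in> A \<union> B"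
      proof (rule ccontr)
        assume "a \<notin> A \<union> B"
        then have "rspace U a = {0}" "rspace W a = {0}" using A(2) B(2) by simp_all
        moreover have "a \<in> verts Q" using nz[OF a] by blast
        note conjunct2[OF summands[OF this]]
        ultimately have "rspace M a = {0}" using a by simp
        then show False using nz[OF a] by blast
      qed
    qed
    have "A = {} \<or> B = {}"
    proof (rule ccontr)
      assume "\<not> ?thesis"
      then obtain a b where "a \<in> A" "b \<in> B" by blast
      then obtain \<alpha> where \<alpha>: "\<alpha> \<in> arcs R" "(tail R \<alpha> \<in> A) \<noteq> (head R \<alpha> \<in> A)"
        using connected_crossing[OF wfR R(2), of a A b] AB disj by blast
      have "tail R \<alpha> \<in> verts R" "head R \<alpha> \<in> verts R" using \<alpha>(1) wfR by (auto simp: wf_digraph_def)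
      then have "(tail Q \<alpha> \<in> A \<and> head Q \<alpha> \<in> B) \<or> (tail Q \<alpha> \<in> B \<and> head Q \<alpha> \<in> A)"
        using \<alpha>(2) cover disj unfolding arcsR by blast
      moreover have "\<alpha> \<in> arcs T" using \<alpha>(1) arcsR by blast
      ultimately show False using A(1) B(1) disj unfolding closed_def by blast
    qed
    then show ?thesis using A B zero_rep_sub_iff by blast
  qed
  ultimately show ?thesis using sub_representation[OF V] by (auto simp: indecomposable_def)
qed

text \<open>A set of vertices that no arrow crosses is closed along with its complement in
  \<open>V\<close>, and the two restrictions form a direct sum decomposition.\<close>

lemma connected_supp_sub:
  assumes V: "closed V" and indec: "indecomposable Q (sub V)"
  shows "Digraph_Component.connected (supp Q (sub V))"
proof (rule connectedI)
  show "wf_digraph (supp Q (sub V))" using wf_supp[OF wf] sub_representation[OF V] by blast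
  show "verts (supp Q (sub V)) \<noteq> {}"
    using indec zero_rep_sub_iff[OF V] unfolding verts_supp_sub[OF V] indecomposable_def by blast
  fix A assume "A \<subseteq> verts (supp Q (sub V))" "A \<noteq> {}" "A \<noteq> verts (supp Q (sub V))"
  then have A: "A \<subseteq> V" "A \<noteq> {}" "V - A \<noteq> {}" unfolding verts_supp_sub[OF V] by blast+
  show "\<exists>\<alpha>\<in>arcs (supp Q (sub V)). (tail (supp Q (sub V)) \<alpha> \<in> A) \<noteq> (head (supp Q (sub V)) \<alpha> \<in> A)"
  proof (rule ccontr)
    assume "\<not> ?thesis"
    then have no: "\<And>\<alpha>. \<lbrakk>\<alpha> \<in> arcs T; tail Q \<alpha> \<in> V\<rbrakk> \<Longrightarrow> tail Q \<alpha> \<in> A \<longleftrightarrow> head Q \<alpha> \<in> A"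
      by (simp add: arcs_supp_sub[OF V] supp_simps(1,2))
    have cl: "closed A" "closed (V - A)" using V A no unfolding closed_def by blast+
    have "direct_sum_of Q (sub V) (sub A) (sub (V - A))"
      unfolding direct_sum_of_def
    proof (intro conjI ballI)
      show "subrep Q (sub A) (sub V)" "subrep Q (sub (V - A)) (sub V)"
        using cl V A sub_subrep by blast+
      fix a
      show "rspace (sub A) a \<inter> rspace (sub (V - A)) a = {0}"
        using rep_zero_in[OF rep] by auto
      show "rspace (sub V) a = {u + v | u v. u \<in> rspace (sub A) a \<and> v \<in> rspace (sub (V - A)) a}"
        using A(1) by auto
    qed
    then have "A = {} \<or> V - A = {}"
      using indec zero_rep_sub_iff cl unfolding indecomposable_def by blast
    then show False using A by blast
  qed
qed

text \<open>Removing a source \<open>a\<close> leaves a closed set, and the quotient is the simple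
  representation at \<open>a\<close>; additivity of \<open>l\<close> then adds the weights one
  vertex at a time.\<close>

lemma length_sub_weights:
  assumes l: "length_function Q l" and w: "\<And>i. i \<in> verts Q \<Longrightarrow> w i = l (simple_rep i)"
    and "closed V"
  shows "l (sub V) = sum w V"
proof -
  have "V \<subseteq> verts Q" using assms(3) by (auto simp: closed_def)
  then have "finite V" using finite_verts finite_subset by blast
  then show ?thesis using assms(3)
  proof (induction V rule: finite_psubset_induct)
    case (psubset V)
    show ?case
    proof (cases "V = {}")
      case True
      then show ?thesis
        using l psubset.prems sub_representation zero_rep_sub_iff unfolding length_function_def by simp
    next
      case False
      then obtain a where a: "a \<in> V" and source: "\<And>\<alpha>. \<alpha> \<in> arcs T \<Longrightarrow> head Q \<alpha> = a \<Longrightarrow> tail Q \<alpha> \<notin> V"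
        using exists_source[OF acyclic arcs_T] by metis
      have aQ: "a \<in> verts Q" "rspace M a \<noteq> {0}" using a psubset.prems by (auto simp: closed_def)
      obtain x where x: "x \<in> rspace M a" "x \<noteq> 0" using aQ rep_nonzero_iff[OF rep] by blast
      have line: "rspace M a = seqs.span {x}" using rspace_line x by blast
      have cl: "closed (V - {a})"
        using psubset.prems source unfolding closed_def by blast
      define \<psi> where "\<psi> = (\<lambda>b v. if b = a then line_map x unit_seq v else (0 :: 'k seq))"
      have incl: "rep_hom Q (sub (V - {a})) (sub V) (\<lambda>_ v. v)"
        using cl psubset.prems sub_subrep[of "V - {a}" V]
        by (auto simp: rep_hom_def linear_on_def subrep_def simp del: sub_simps)
      have proj: "rep_hom Q (sub V) (simple_rep a) \<psi>"
        unfolding rep_hom_def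
      proof (intro conjI ballI)
        fix b
        show "linear_on (rspace (sub V) b) (rspace (simple_rep a) b) (\<psi> b)"
          using linear_on_line_map[OF x(2), of unit_seq] a line
          by (auto simp: \<psi>_def simple_rep_def unit_line_eq linear_on_def)
      next
        fix \<alpha> v assume \<alpha>: "\<alpha> \<in> arcs Q" "v \<in> rspace (sub V) (tail Q \<alpha>)"
        \<comment> \<open>No support arrow runs from \<open>V\<close> into the source. This makes
          the projection commute with the structural maps, since those of the simple representation
          are zero.\<close>
        have "rmap (sub V) \<alpha> v = 0" if "head Q \<alpha> = a"
          using that source rmap_eq_0 by auto
        then have "\<psi> (head Q \<alpha>) (rmap (sub V) \<alpha> v) = 0"
          using line_map_0[OF x(2)] by (auto simp: \<psi>_def simp del: sub_simps)
        then show "\<psi> (head Q \<alpha>) (rmap (sub V) \<alpha> v) = rmap (simple_rep a) \<alpha> (\<psi> (tail Q \<alpha>) v)"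
          by (simp add: simple_rep_def)
      qed
      have exact: "inj_on (\<lambda>v. v) (rspace (sub (V - {a})) b) \<and>
          (\<lambda>v. v) ` rspace (sub (V - {a})) b = {v \<in> rspace (sub V) b. \<psi> b v = 0} \<and>
          \<psi> b ` rspace (sub V) b = rspace (simple_rep a) b" for b
      proof (cases "b = a")
        case True
        have "{v \<in> rspace M a. line_map x unit_seq v = 0} = {0}"
          using x unit_seq_nonzero unfolding line by (auto simp: seqs.span_singleton line_map_0)
        moreover have "line_map x unit_seq ` rspace M a = unit_line"
          using bij_betw_line_map[OF x(2) unit_seq_nonzero]
          unfolding line unit_line_eq bij_betw_def by blast
        ultimately show ?thesis using True a by (simp add: \<psi>_def simple_rep_def)
      next
        case False
        then show ?thesis using rep_zero_in[OF rep, of b] by (auto simp: \<psi>_def simple_rep_def)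
      qed
      have "short_exact Q (sub (V - {a})) (sub V) (simple_rep a) (\<lambda>_ v. v) \<psi>"
        unfolding short_exact_def using incl proj exact by blast
      then have "l (sub V) = l (sub (V - {a})) + l (simple_rep a)"
        using l sub_representation cl psubset.prems simple_rep_representation[OF aQ(1)]
        unfolding length_function_def by blast
      also have "\<dots> = sum w (V - {a}) + w a"
        using psubset.IH[OF _ cl] a w aQ by auto
      also have "\<dots> = sum w V" using a psubset.hyps by (simp add: sum.remove)
      finally show ?thesis .
    qed
  qed
qed

subsection \<open>Canonical form\<close>

text \<open>
  Without cycles, the ends of a new arrow lie in different components of the old arrows,
  and rescaling the basis vectors on one of them adjusts the new structural map.
\<close>

lemma exists_compatible_basis:
  assumes "finite A" "A \<subseteq> arcs T"
    and "\<And>\<alpha>. \<alpha> \<in> A \<Longrightarrow> tail Q \<alpha> \<in> V \<and> head Q \<alpha> \<in> V"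
    and no_cycle: "\<And>C. subgraph C T \<Longrightarrow> underlying_cycle C \<Longrightarrow> \<not> verts C \<subseteq> V"
  shows "\<exists>x. (\<forall>a\<in>verts T. x a \<in> rspace M a \<and> x a \<noteq> 0) \<and>
    (\<forall>\<alpha>\<in>A. rmap M \<alpha> (x (tail Q \<alpha>)) = x (head Q \<alpha>))"
  using assms(1-3)
proof (induction A rule: finite_induct)
  case empty
  have "\<forall>a\<in>verts T. \<exists>x. x \<in> rspace M a \<and> x \<noteq> 0" using rep_nonzero_iff[OF rep] by auto
  then show ?case by (metis empty_iff)
next
  case (insert \<alpha> A)
  have "\<exists>x. (\<forall>a\<in>verts T. x a \<in> rspace M a \<and> x a \<noteq> 0) \<and>
      (\<forall>\<alpha>\<in>A. rmap M \<alpha> (x (tail Q \<alpha>)) = x (head Q \<alpha>))"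
    by (rule insert.IH) (use insert.prems in auto)
  then obtain x where x: "\<And>a. a \<in> verts T \<Longrightarrow> x a \<in> rspace M a \<and> x a \<noteq> 0"
      "\<And>\<beta>. \<beta> \<in> A \<Longrightarrow> rmap M \<beta> (x (tail Q \<beta>)) = x (head Q \<beta>)"
    by blast
  have \<alpha>: "\<alpha> \<in> arcs T" "\<alpha> \<in> arcs Q" using insert.prems arcs_T by auto
  \<comment> \<open>\<open>D\<close> is the component of the head with respect to the old arrows. If
    it contained the tail, the new arrow would close a cycle inside \<open>V\<close>.\<close>
  define D where "D = {b. (b, head Q \<alpha>) \<in> (und Q A)\<^sup>*}"
  have "tail Q \<alpha> \<notin> D"
  proof
    assume "tail Q \<alpha> \<in> D"
    then have "(tail T \<alpha>, head T \<alpha>) \<in> (und T A)\<^sup>*" by (simp add: D_def und_def)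
    then show False
      using underlying_cycle_of_path_and_arc[OF wf_supp[OF wf rep], of A \<alpha> V]
        insert.prems insert.hyps no_loops[OF \<alpha>(2)] no_cycle
      by auto
  qed
  have D_iff: "tail Q \<beta> \<in> D \<longleftrightarrow> head Q \<beta> \<in> D" if "\<beta> \<in> A" for \<beta>
  proof -
    have "(tail Q \<beta>, head Q \<beta>) \<in> und Q A" using that by (rule und_arcI)
    moreover from this have "(head Q \<beta>, tail Q \<beta>) \<in> und Q A" using sym_und symE by metis
    ultimately show ?thesis unfolding D_def mem_Collect_eq by (meson converse_rtrancl_into_rtrancl)
  qed
  have ends: "tail Q \<beta> \<in> verts T" "head Q \<beta> \<in> verts T" if "\<beta> \<in> insert \<alpha> A" for \<beta>
    using that insert.prems wf_T by blast+
  have xt: "x (tail Q \<alpha>) \<in> rspace M (tail Q \<alpha>)" "x (tail Q \<alpha>) \<noteq> 0"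
    and xh: "x (head Q \<alpha>) \<in> rspace M (head Q \<alpha>)" "x (head Q \<alpha>) \<noteq> 0"
    using x(1) ends by auto
  obtain c where c: "rmap M \<alpha> (x (tail Q \<alpha>)) = seq_scale c (x (head Q \<alpha>))"
    using rmap_in[OF \<alpha>(2) xt(1)] rspace_line[OF xh] by (auto simp: seqs.span_singleton)
  then have "c \<noteq> 0" using rmap_neq_0[OF \<alpha>(1) xt] by auto
  \<comment> \<open>Scaling on \<open>D\<close> changes the vector at the head of the new arrow but
    not at its tail, which absorbs the factor \<open>c\<close>. Each old arrow has both ends in
    \<open>D\<close> or neither, so linearity preserves its relation.\<close>
  define y where "y = (\<lambda>b. if b \<in> D then seq_scale c (x b) else x b)"
  have "y a \<in> rspace M a \<and> y a \<noteq> 0" if "a \<in> verts T" for a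
    using x(1)[OF that] \<open>c \<noteq> 0\<close> rep_subspace[OF rep] by (simp add: y_def seqs.subspace_scale)
  moreover have "rmap M \<beta> (y (tail Q \<beta>)) = y (head Q \<beta>)" if \<beta>: "\<beta> \<in> insert \<alpha> A" for \<beta>
  proof (cases "\<beta> = \<alpha>")
    case True
    moreover have "head Q \<alpha> \<in> D" by (simp add: D_def)
    ultimately show ?thesis using \<open>tail Q \<alpha> \<notin> D\<close> c by (simp add: y_def)
  next
    case False
    then have \<beta>A: "\<beta> \<in> A" using \<beta> by blast
    then have "\<beta> \<in> arcs Q" using insert.prems arcs_T by blast
    moreover have "x (tail Q \<beta>) \<in> rspace M (tail Q \<beta>)" using x(1) ends(1)[OF \<beta>] by blast
    ultimately show ?thesis
      using x(2)[OF \<beta>A] D_iff[OF \<beta>A] rmap_scale by (simp add: y_def)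
  qed
  ultimately show ?case by blast
qed

text \<open>Absence of cycles does two things: \<open>R\<close> contains every support arrow
  starting in it, so both representations have nonzero maps along the same arrows; and a compatible
  basis exists, which the isomorphism sends to the unit vectors.\<close>

lemma rep_iso_canonical:
  assumes R: "subgraph R T" "Digraph_Component.connected R" and V: "closed (verts R)"
    and no_cycle: "\<And>C. subgraph C T \<Longrightarrow> underlying_cycle C \<Longrightarrow> \<not> verts C \<subseteq> verts R"
  shows "rep_iso Q (sub (verts R)) (canonical_rep R)"
proof -
  have wfR: "wf_digraph R" and vertsR: "verts R \<subseteq> verts T"
    and arcsR: "arcs R \<subseteq> arcs T" "tail R = tail Q" "head R = head Q"
    using R(1) by (auto simp: subgraph_def compatible_def)
  have ends: "tail Q \<alpha> \<in> verts R" "head Q \<alpha> \<in> verts R" if "\<alpha> \<in> arcs R" for \<alpha>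
    using that wfR arcsR by (auto simp: wf_digraph_def)
  \<comment> \<open>Closedness puts the head into \<open>R\<close> as well, and connectedness joins
    both ends by a path of arrows of \<open>R\<close>; a missing arrow would close a cycle on the
    vertices of \<open>R\<close>.\<close>
  have arcs: "\<alpha> \<in> arcs R" if \<alpha>: "\<alpha> \<in> arcs T" "tail Q \<alpha> \<in> verts R" for \<alpha>
  proof (rule ccontr)
    assume "\<alpha> \<notin> arcs R"
    have h: "head Q \<alpha> \<in> verts R" using \<alpha> V unfolding closed_def by blast
    then have "(tail T \<alpha>, head T \<alpha>) \<in> (und T (arcs R))\<^sup>*"
      using R(2) \<alpha>(2) unfolding connected_iff_und[OF wfR] by (simp add: und_def arcsR)
    moreover have "tail T \<alpha> \<noteq> head T \<alpha>" using no_loops \<alpha>(1) arcs_T by auto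
    ultimately show False
      using underlying_cycle_of_path_and_arc[OF wf_supp[OF wf rep] arcsR(1), of \<alpha> "verts R"]
        \<alpha> \<open>\<alpha> \<notin> arcs R\<close> ends h no_cycle by auto
  qed
  have "finite (arcs R)" using arcsR(1) arcs_T finite_arcs by (meson finite_subset)
  then obtain x where x: "\<And>a. a \<in> verts T \<Longrightarrow> x a \<in> rspace M a \<and> x a \<noteq> 0"
      "\<And>\<alpha>. \<alpha> \<in> arcs R \<Longrightarrow> rmap M \<alpha> (x (tail Q \<alpha>)) = x (head Q \<alpha>)"
    using exists_compatible_basis[OF _ arcsR(1), of "verts R"] ends no_cycle by metis
  have x0: "x a \<noteq> 0" and line: "rspace M a = seqs.span {x a}" if "a \<in> verts R" for a
    using x(1) that vertsR rspace_line by blast+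
  define \<phi> where "\<phi> = (\<lambda>a v. if a \<in> verts R then line_map (x a) unit_seq v else (0 :: 'k seq))"
  have "linear_on (rspace (sub (verts R)) a) (rspace (canonical_rep R) a) (\<phi> a)" for a
    using linear_on_line_map[OF x0, of a unit_seq] line[of a]
    by (cases "a \<in> verts R") (auto simp: \<phi>_def canonical_rep_def unit_line_eq linear_on_def)
  moreover have "bij_betw (\<phi> a) (rspace (sub (verts R)) a) (rspace (canonical_rep R) a)" for a
    using bij_betw_line_map[OF x0 unit_seq_nonzero, of a] line[of a]
    by (cases "a \<in> verts R") (simp_all add: \<phi>_def canonical_rep_def unit_line_eq bij_betw_def)
  moreover have "\<phi> (head Q \<alpha>) (rmap (sub (verts R)) \<alpha> v) = rmap (canonical_rep R) \<alpha> (\<phi> (tail Q \<alpha>) v)"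
    if \<alpha>: "\<alpha> \<in> arcs Q" "v \<in> rspace (sub (verts R)) (tail Q \<alpha>)" for \<alpha> v
  proof (cases "\<alpha> \<in> arcs R")
    case True
    then obtain c where c: "v = seq_scale c (x (tail Q \<alpha>))"
      using \<alpha>(2) ends(1) line by (auto simp: seqs.span_singleton)
    have "x (tail Q \<alpha>) \<in> rspace M (tail Q \<alpha>)" using x(1) ends(1)[OF True] vertsR by blast
    then have "rmap M \<alpha> v = seq_scale c (x (head Q \<alpha>))"
      unfolding c using rmap_scale[OF \<alpha>(1)] x(2)[OF True] by simp
    moreover have "seq_scale c unit_seq \<in> unit_line" by (auto simp: unit_line_eq seqs.span_singleton)
    ultimately show ?thesis
      using True ends[OF True] x0 c by (simp add: \<phi>_def canonical_rep_def)
  next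
    case False
    then have "rmap (sub (verts R)) \<alpha> v = 0" using arcs rmap_eq_0 by auto
    then show ?thesis using False line_map_0[OF x0]
      by (simp add: \<phi>_def canonical_rep_def del: sub_simps)
  qed
  ultimately show ?thesis unfolding rep_iso_def rep_hom_def by blast
qed

end

section \<open>Comparison of the two posets\<close>

lemma filtration_imp_chain:
  assumes "filtration S le x X" and refl: "\<And>y. y \<in> S \<Longrightarrow> le y y"
  shows "finite_chain_to S le x X"
proof -
  obtain xs where xs: "xs \<noteq> []" "X = set xs" "X \<subseteq> S"
      "sorted_wrt (\<lambda>y z. le y z \<and> y \<noteq> z) xs" "last xs = x"
    using assms(1) unfolding filtration_def by blast
  \<comment> \<open>\<open>sorted_wrt\<close> relates all pairs of positions, not only neighbours,
    so reflexivity supplies just the diagonal.\<close>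
  have le: "le (xs ! i) (xs ! j)" if "i \<le> j" "j < length xs" for i j
  proof (cases "i = j")
    case True
    then show ?thesis using that xs(2,3) refl nth_mem by blast
  next
    case False
    then show ?thesis using that xs(4) by (simp add: sorted_wrt_iff_nth_less)
  qed
  have "le y z \<or> le z y" if yz: "y \<in> X" "z \<in> X" for y z
  proof -
    obtain i j where "i < length xs" "y = xs ! i" "j < length xs" "z = xs ! j"
      using yz unfolding xs(2) in_set_conv_nth by blast
    then show ?thesis using le by (metis nat_le_linear)
  qed
  moreover have "le y x" if y: "y \<in> X" for y
  proof -
    obtain i where "i < length xs" "y = xs ! i" using y unfolding xs(2) in_set_conv_nth by blast
    then show ?thesis using le[of i "length xs - 1"] xs(1,5) by (auto simp: last_conv_nth)
  qed
  moreover have "x \<in> X" using xs by auto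
  ultimately show ?thesis using xs(2,3) by (simp add: finite_chain_to_def)
qed

context thin_representation
begin

lemma connected_below_T:
  assumes "R \<in> connected_subquivers Q" "le_C R T"
  shows "subgraph R T" "Digraph_Component.connected R" "closed (verts R)"
proof -
  show R: "subgraph R T" "Digraph_Component.connected R"
    using assms by (simp_all add: connected_subquivers_def le_C_def)
  show "closed (verts R)"
    using R(1) assms(2) unfolding closed_def le_C_def subgraph_def supp_simps(1,2) by blast
qed

lemma le_C_supp_sub:
  assumes "closed V" "closed W" "V \<subseteq> W"
  shows "le_C (supp Q (sub V)) (supp Q (sub W))"
proof -
  have "subgraph (supp Q (sub V)) (supp Q (sub W))"
    using assms(3) wf_supp[OF wf sub_representation] assms(1,2)
    unfolding subgraph_def compatible_def
    by (auto simp: arcs_supp_sub verts_supp_sub simp del: supp_simps(3))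
  moreover have "head Q \<alpha> \<in> V" if "\<alpha> \<in> arcs T" "tail Q \<alpha> \<in> V" for \<alpha>
    using that assms(1) unfolding closed_def by blast
  ultimately show ?thesis
    unfolding le_C_def verts_supp_sub[OF assms(1)] arcs_supp_sub[OF assms(2)] supp_simps(1,2)
    by blast
qed

lemma le_C_supp_sub_T: "closed V \<Longrightarrow> le_C (supp Q (sub V)) T"
  using le_C_supp_sub[of V "verts T"] closed_T unfolding sub_T closed_def by blast

lemma sub_verts_in_indec_subobjects:
  assumes "R \<in> connected_subquivers Q" "le_C R T"
  shows "sub (verts R) \<in> indec_subobjects Q M"
  using connected_below_T[OF assms] indecomposable_sub sub_subrep_M
  by (simp add: indec_subobjects_def)

lemma indec_subobjects_obtain:
  assumes "N \<in> indec_subobjects Q M"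
  obtains V where "closed V" "N = sub V" "supp Q N \<in> connected_subquivers Q"
proof -
  have N: "subrep Q N M" "indecomposable Q N" using assms by (auto simp: indec_subobjects_def)
  obtain V where V: "closed V" "N = sub V" using subrep_M_obtain[OF N(1)] by blast
  have "supp Q N \<in> connected_subquivers Q"
    using N V connected_supp_sub subgraph_supp[OF wf] by (auto simp: connected_subquivers_def subrep_def)
  with V that show thesis by blast
qed

end

section \<open>Weights and lengths of chains\<close>

locale thin_representation_length = thin_representation Q M
  for Q :: "('a, 'b) pre_digraph" and M :: "('a, 'b, 'k::field) qrep" +
  fixes l :: "('a, 'b, 'k) qrep \<Rightarrow> real" and w :: "'a \<Rightarrow> real"
  assumes length: "length_function Q l"
    and weight: "\<And>i. i \<in> verts Q \<Longrightarrow> w i = l (simple_rep i)"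
begin

lemma length_sub: "closed V \<Longrightarrow> l (sub V) = sum w V"
  using length_sub_weights[OF length weight] by blast

lemma weight_pos:
  assumes "i \<in> verts Q"
  shows "w i > 0"
  using assms length weight simple_rep_representation simple_rep_nonzero
  unfolding length_function_def by (metis less_le)

text \<open>The abstract results are applied to subobjects rather than to subquivers: there a proper
  inclusion adds a vertex of positive weight, while a cycle and the cycle without one arrow have
  equal \<open>weight_length\<close>.\<close>

sublocale finite_length_poset "indec_subobjects Q M" "subrep Q" l
proof
  have "indec_subobjects Q M \<subseteq> sub ` Pow (verts T)"
  proof
    fix N assume "N \<in> indec_subobjects Q M"
    then obtain V where "closed V" "N = sub V" using indec_subobjects_obtain by blast
    then show "N \<in> sub ` Pow (verts T)" unfolding closed_def by blast
  qed
  moreover have "finite (verts T)" using finite_verts by simp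
  ultimately show "finite (indec_subobjects Q M)" using finite_subset by blast
next
  fix X assume "X \<in> indec_subobjects Q M"
  then show "subrep Q X X" by (auto simp: indec_subobjects_def subrep_def)
next
  fix X Y assume X: "X \<in> indec_subobjects Q M" and Y: "Y \<in> indec_subobjects Q M"
  obtain V where V: "closed V" "X = sub V" using X indec_subobjects_obtain by blast
  obtain W where W: "closed W" "Y = sub W" using Y indec_subobjects_obtain by blast
  have iff: "subrep Q X Y \<longleftrightarrow> V \<subseteq> W" "subrep Q Y X \<longleftrightarrow> W \<subseteq> V"
    unfolding V(2) W(2) by (rule sub_subrep_iff[OF V(1) W(1)], rule sub_subrep_iff[OF W(1) V(1)])
  show "X = Y" if "subrep Q X Y" "subrep Q Y X"
  proof -
    have "V = W" using that unfolding iff by (rule subset_antisym)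
    then show ?thesis by (simp only: V(2) W(2))
  qed
  show "l X < l Y" if XY: "subrep Q X Y" "X \<noteq> Y"
  proof -
    have "V \<noteq> W" using XY(2) unfolding V(2) W(2) by blast
    moreover have "V \<subseteq> W" using XY(1) unfolding iff .
    ultimately have "V \<subset> W" by blast
    have "W \<subseteq> verts Q" using W(1) by (auto simp: closed_def)
    then have "finite W" "\<And>i. i \<in> W \<Longrightarrow> w i > 0"
      using finite_verts finite_subset weight_pos by blast+
    moreover obtain b where "b \<in> W - V" using \<open>V \<subset> W\<close> by blast
    ultimately have "sum w V < sum w W"
      using \<open>V \<subset> W\<close> by (intro sum_strict_mono2[of W V b]) (auto intro: less_imp_le)
    then show ?thesis using V W length_sub by simp
  qed
next
  show "subrep Q X Z" if "subrep Q X Y" "subrep Q Y Z" for X Y Z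
    using that subrep_trans[OF wf] by blast
qed

text \<open>Restriction is monotone and sends the support to \<open>M\<close>, but may merge a cycle
  with the cycle lacking one arrow. Their lengths agree, so the set of lengths survives.\<close>

lemma chain_of_subquivers:
  assumes "finite_chain_to (connected_subquivers Q) le_C T X"
  shows "finite_chain_to (indec_subobjects Q M) (subrep Q) M ((\<lambda>R. sub (verts R)) ` X)"
    and "l ` (\<lambda>R. sub (verts R)) ` X = weight_length w ` X"
proof -
  have X: "X \<subseteq> connected_subquivers Q" "finite X" "T \<in> X"
      "\<And>R. R \<in> X \<Longrightarrow> le_C R T" "\<And>R R'. R \<in> X \<Longrightarrow> R' \<in> X \<Longrightarrow> le_C R R' \<or> le_C R' R"
    using assms by (auto simp: finite_chain_to_def)
  have closed: "closed (verts R)" if "R \<in> X" for R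
    using that X connected_below_T(3) by blast
  have "subrep Q (sub (verts R)) (sub (verts R'))" if "R \<in> X" "R' \<in> X" "le_C R R'" for R R'
    using that closed sub_subrep by (simp add: le_C_def subgraph_def)
  moreover have "sub (verts R) \<in> indec_subobjects Q M" if "R \<in> X" for R
    using that X sub_verts_in_indec_subobjects by blast
  moreover have "M \<in> (\<lambda>R. sub (verts R)) ` X" using X(3) sub_T by (metis imageI)
  moreover have "subrep Q (sub (verts R)) M" if "R \<in> X" for R
    using that closed sub_subrep_M by blast
  ultimately show "finite_chain_to (indec_subobjects Q M) (subrep Q) M ((\<lambda>R. sub (verts R)) ` X)"
    using X(2,5) unfolding finite_chain_to_def by blast
  show "l ` (\<lambda>R. sub (verts R)) ` X = weight_length w ` X"
    unfolding image_image using closed length_sub by (simp add: weight_length_def)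
qed

text \<open>Taking supports turns inclusion into \<open>le_C\<close>, and the vertices of the
  support retain the length. With the preceding lemma, both kinds of chains realise the same sets of
  lengths.\<close>

lemma chain_of_subobjects:
  assumes "finite_chain_to (indec_subobjects Q M) (subrep Q) M Y"
  shows "finite_chain_to (connected_subquivers Q) le_C T (supp Q ` Y)"
    and "weight_length w ` supp Q ` Y = l ` Y"
proof -
  have Y: "Y \<subseteq> indec_subobjects Q M" "finite Y" "M \<in> Y"
      "\<And>N N'. N \<in> Y \<Longrightarrow> N' \<in> Y \<Longrightarrow> subrep Q N N' \<or> subrep Q N' N"
    using assms by (auto simp: finite_chain_to_def)
  have "le_C (supp Q N) (supp Q N')" if NN': "N \<in> Y" "N' \<in> Y" "subrep Q N N'" for N N'
  proof -
    obtain V where V: "closed V" "N = sub V" using NN' Y(1) indec_subobjects_obtain by blast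
    obtain W where W: "closed W" "N' = sub W" using NN' Y(1) indec_subobjects_obtain by blast
    have "V \<subseteq> W" using NN'(3) sub_subrep_iff[OF V(1) W(1)] unfolding V(2) W(2) by simp
    then show ?thesis unfolding V(2) W(2) by (rule le_C_supp_sub[OF V(1) W(1)])
  qed
  moreover have "supp Q N \<in> connected_subquivers Q" "le_C (supp Q N) T" "l N = weight_length w (supp Q N)"
    if N: "N \<in> Y" for N
  proof -
    obtain V where V: "closed V" "N = sub V" "supp Q N \<in> connected_subquivers Q"
      using N Y(1) indec_subobjects_obtain by blast
    show "supp Q N \<in> connected_subquivers Q" by fact
    show "le_C (supp Q N) T" using V le_C_supp_sub_T by blast
    show "l N = weight_length w (supp Q N)"
      unfolding weight_length_def V(2) verts_supp_sub[OF V(1)] by (rule length_sub[OF V(1)])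
  qed
  ultimately show "finite_chain_to (connected_subquivers Q) le_C T (supp Q ` Y)"
    "weight_length w ` supp Q ` Y = l ` Y"
    using Y(2-4) unfolding finite_chain_to_def by (blast, force simp: image_image)
qed

lemma gr_measure_eq:
  "gr_measure Q l M = chain_length (connected_subquivers Q) le_C (weight_length w) T"
  unfolding gr_measure_def
proof (rule chain_length_eqI)
  fix Y assume "finite_chain_to (indec_subobjects Q M) (subrep Q) M Y"
  note chain_of_subobjects[OF this]
  then show "\<exists>X. finite_chain_to (connected_subquivers Q) le_C T X \<and> weight_length w ` X = l ` Y"
    by (intro exI conjI)
next
  fix X assume "finite_chain_to (connected_subquivers Q) le_C T X"
  note chain_of_subquivers[OF this]
  then show "\<exists>Y. finite_chain_to (indec_subobjects Q M) (subrep Q) M Y \<and> l ` Y = weight_length w ` X"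
    by (intro exI conjI)
qed

text \<open>By \<open>gr_measure_eq\<close> the image of the filtration has the maximal set of
  lengths, and maximality yields the filtration property.\<close>

lemma gr_filtration_of_star_filtration:
  assumes "star_filtration (connected_subquivers Q) le_C (weight_length w) T X"
  shows "finite_chain_to (connected_subquivers Q) le_C T X"
    and "gr_filtration Q l M ((\<lambda>R. sub (verts R)) ` X)"
proof -
  have filt: "filtration (connected_subquivers Q) le_C T X"
    using assms by (simp add: star_filtration_def)
  show X: "finite_chain_to (connected_subquivers Q) le_C T X"
    by (rule filtration_imp_chain[OF filt])
      (auto simp: connected_subquivers_def subgraph_def le_C_def compatible_def wf_digraph_def)
  have "l ` (\<lambda>R. sub (verts R)) ` X = chain_length (indec_subobjects Q M) (subrep Q) l M"
    using chain_of_subquivers(2)[OF X] assms gr_measure_eq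
    by (simp add: star_filtration_def gr_measure_def)
  then show "gr_filtration Q l M ((\<lambda>R. sub (verts R)) ` X)"
    unfolding gr_filtration_def by (rule star_filtration_if_maximal[OF chain_of_subquivers(1)[OF X]])
qed

end

theorem proposition15:
  fixes Q :: "('a, 'b) pre_digraph"
    and M :: "('a, 'b, 'k::field) qrep"
    and l :: "('a, 'b, 'k) qrep \<Rightarrow> real"
    and w :: "'a \<Rightarrow> real"
  assumes "acyclic_quiver Q"
    and "representation Q M"
    and "thin Q M"
    and "underlying_tree (supp Q M) \<or> underlying_cycle (supp Q M)"
    and "length_function Q l"
    and "\<And>i. i \<in> verts Q \<Longrightarrow> w i = l (simple_rep i)"
  shows "indecomposable Q M \<and>
    gr_measure Q l M =
      chain_length (connected_subquivers Q) le_C (weight_length w) (supp Q M) \<and>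
    (\<forall>\<Q>. star_filtration (connected_subquivers Q) le_C (weight_length w) (supp Q M) \<Q> \<longrightarrow>
       gr_filtration Q l M (restrict_rep Q M ` \<Q>) \<and>
       (\<forall>R\<in>\<Q>. underlying_tree (supp Q M) \<or> verts R \<noteq> verts (supp Q M) \<longrightarrow>
          rep_iso Q (restrict_rep Q M R) (canonical_rep R)))"
proof -
  interpret thin_representation_length Q M l w
    using assms by unfold_locales auto
  have restrict: "restrict_rep Q M = (\<lambda>R. sub (verts R))"
    using restrict_rep_eq_sub by blast
  have "Digraph_Component.connected T"
    using assms(4) underlying_cycle_connected[OF wf_supp[OF wf rep]] by (auto simp: underlying_tree_def)
  moreover have "subgraph T T"
    using wf_supp[OF wf rep] by (simp add: subgraph_def compatible_def)
  \<comment> \<open>The support is itself a closed connected subquiver, and restricting to it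
    returns \<open>M\<close>.\<close>
  ultimately have "indecomposable Q M"
    using indecomposable_sub[of T] closed_T unfolding sub_T by blast
  moreover have "rep_iso Q (sub (verts R)) (canonical_rep R)"
    if X: "star_filtration (connected_subquivers Q) le_C (weight_length w) T X" "R \<in> X"
      and R: "underlying_tree T \<or> verts R \<noteq> verts T" for X R
  proof -
    have "R \<in> connected_subquivers Q" "le_C R T"
      using gr_filtration_of_star_filtration(1)[OF X(1)] X(2) by (auto simp: finite_chain_to_def)
    note below = connected_below_T[OF this]
    show ?thesis
    proof (rule rep_iso_canonical[OF below])
      \<comment> \<open>A tree contains no cycle at all. If the support is a cycle, any cycle in it
        passes through all vertices, so it cannot fit into a subquiver that misses one.\<close>
      fix C assume C: "subgraph C T" "underlying_cycle C"
      then have "\<not> underlying_tree T" unfolding underlying_tree_def by blast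
      then have "verts R \<noteq> verts T" "underlying_cycle T" using R assms(4) by blast+
      then have "verts C = verts T" "verts R \<subset> verts T"
        using C underlying_cycle_in_cycle below(3) unfolding closed_def by blast+
      then show "\<not> verts C \<subseteq> verts R" by blast
    qed
  qed
  ultimately show ?thesis
    unfolding restrict using gr_measure_eq gr_filtration_of_star_filtration(2) by blast
qed

end
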